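(* Let $m\ge1$ and $n:=2m+1$. There is a constant $C$ depending only on $m$ such that the following holds. Let $0<\varrho\le1$ and $t,b>0$ satisfy $$t\ge b+3\varrho^2,$$ and define $A_0:=B_\varrho\times[0,b]$ and $A_1:=B_\varrho\times[t,t+b]$ (subsets of $\mathbb{H}^m\cong\mathbb{R}^{2m}\times\mathbb{R}$), where $B_\varrho$ is the Euclidean ball of radius $\varrho$ centered at $0$ in $\mathbb{R}^{2m}$. Then the contact magnetic Minkowski $(1/2)$-average $A_{1/2}$ of $A_0$ and $A_1$ satisfies $$\mathrm{Vol}(A_{1/2})^{1/n}\le\left(1+C\,\frac{\varrho^2}{b}\right)\frac{\mathrm{Vol}(A_0)^{1/n}+\mathrm{Vol}(A_1)^{1/n}}{2}.$$
   Context: $\mathbb{H}^m$ is the Heisenberg group with coordinates $(x,y,z)\in\mathbb{R}^m\times\mathbb{R}^m\times\mathbb{R}$, identified with $\mathbb{R}^{2m}\times\mathbb{R}$ via $((x,y),z)$, with contact form $\eta=dz-\sum_{j=1}^m y^j\,dx^j$ and left-invariant Riemannian metric $g=\sum_j(dx^j)^2+\sum_j(dy^j)^2+\eta^2$; $\mathrm{Vol}$ is its Riemannian volume. A minimizing $1$-magnetic geodesic is a unit-speed curve $\gamma:[0,\ell]\to\mathbb{H}^m$ minimizing $\mathrm{Len}_g-\int\eta$ among all piecewise-$C^1$ curves with the same endpoints (constant curves, $\ell=0$, are included). The contact magnetic Minkowski $\lambda$-average is $$A_\lambda=\{\gamma(\lambda\ell):\gamma:[0,\ell]\to\mathbb{H}^m\text{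 a minimizing 1-magnetic geodesic},\ \gamma(0)\in A_0,\ \gamma(\ell)\in A_1\}.$$ *)

theory Defs
  imports "HOL-Analysis.Analysis"
begin

type_synonym 'm heis = "((real ^ 'm) \<times> (real ^ 'm)) \<times> real"

definition heis_eta :: "'m::finite heis \<Rightarrow> 'm heis \<Rightarrow> real" where
  "heis_eta p v = snd v - (\<Sum>j\<in>UNIV. snd (fst p) $ j * fst (fst v) $ j)"

definition heis_metric :: "'m::finite heis \<Rightarrow> 'm heis \<Rightarrow> 'm heis \<Rightarrow> real" where
  "heis_metric p v w =
     (\<Sum>j\<in>UNIV. fst (fst v) $ j * fst (fst w) $ j)
   + (\<Sum>j\<in>UNIV. snd (fst v) $ j * snd (fst w) $ j)
   + heis_eta p v * heis_eta p w"

definition heis_norm :: "'m::finite heis \<Rightarrow> 'm heis \<Rightarrow> real" where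
  "heis_norm p v = sqrt (heis_metric p v v)"

primrec heis_coord' :: "'m::finite + 'm \<Rightarrow> (real ^ 'm) \<times> (real ^ 'm)" where
  "heis_coord' (Inl j) = (axis j 1, 0)"
| "heis_coord' (Inr j) = (0, axis j 1)"

primrec heis_coord :: "('m::finite + 'm) + unit \<Rightarrow> 'm heis" where
  "heis_coord (Inl i) = (heis_coord' i, 0)"
| "heis_coord (Inr u) = (0, 1)"

definition heis_gram :: "'m::finite heis \<Rightarrow> real ^ (('m + 'm) + unit) ^ (('m + 'm) + unit)" where
  "heis_gram p = (\<chi> i j. heis_metric p (heis_coord i) (heis_coord j))"

definition heis_volume :: "'m::finite heis measure" where
  "heis_volume = density lborel (\<lambda>p. ennreal (sqrt (det (heis_gram p))))"

text \<open>
  The volume is taken as an outer measure, so that it is meaningful for arbitrary sets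
  without a measurability claim; on measurable sets it is the Riemannian volume
  (\<open>outer_measure_of_eq\<close>).
\<close>

definition Vol :: "'m::finite heis set \<Rightarrow> ennreal" where
  "Vol S = outer_measure_of heis_volume S"

text \<open>
  On each closed piece the curve is continuously differentiable up to the end points.  The
  library's \<open>piecewise_C1_differentiable_on\<close> is weaker: it lets the velocity blow up at a
  break point, and then the length integral need not exist.
\<close>

definition piecewise_C1_curve :: "real \<Rightarrow> (real \<Rightarrow> 'a::real_normed_vector) \<Rightarrow> bool" where
  "piecewise_C1_curve l \<gamma> \<longleftrightarrow>
     0 \<le> l \<and> continuous_on {0..l} \<gamma> \<and>
     (\<exists>T. finite T \<and> {0, l} \<subseteq> T \<and> T \<subseteq> {0..l} \<and>
        (\<forall>c\<in>T. \<forall>d\<in>T. c < d \<and> {c<..<d} \<inter> T = {} \<longrightarrow>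
           (\<exists>D. continuous_on {c..d} D \<and>
              (\<forall>s\<in>{c..d}. (\<gamma> has_vector_derivative D s) (at s within {c..d})))))"

definition heis_length :: "real \<Rightarrow> (real \<Rightarrow> 'm::finite heis) \<Rightarrow> real" where
  "heis_length l \<gamma> = integral {0..l} (\<lambda>s. heis_norm (\<gamma> s) (vector_derivative \<gamma> (at s)))"

definition eta_integral :: "real \<Rightarrow> (real \<Rightarrow> 'm::finite heis) \<Rightarrow> real" where
  "eta_integral l \<gamma> = integral {0..l} (\<lambda>s. heis_eta (\<gamma> s) (vector_derivative \<gamma> (at s)))"

text \<open>
  At break points and end points the two-sided derivative need not exist, hence the guards;
  these finitely many points do not affect the integrals either.  For \<open>l = 0\<close> the unit speed
  condition is vacuous, so that constant curves qualify.
\<close>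

definition unit_speed :: "real \<Rightarrow> (real \<Rightarrow> 'm::finite heis) \<Rightarrow> bool" where
  "unit_speed l \<gamma> \<longleftrightarrow>
     (\<forall>s\<in>{0<..<l}. \<gamma> differentiable (at s) \<longrightarrow>
        heis_norm (\<gamma> s) (vector_derivative \<gamma> (at s)) = 1)"

definition minimizing_magnetic_geodesic :: "real \<Rightarrow> (real \<Rightarrow> 'm::finite heis) \<Rightarrow> bool" where
  "minimizing_magnetic_geodesic l \<gamma> \<longleftrightarrow>
     piecewise_C1_curve l \<gamma> \<and> unit_speed l \<gamma> \<and>
     (\<forall>l' \<sigma>. piecewise_C1_curve l' \<sigma> \<and> \<sigma> 0 = \<gamma> 0 \<and> \<sigma> l' = \<gamma> l \<longrightarrow>
        heis_length l \<gamma> - eta_integral l \<gamma> \<le> heis_length l' \<sigma> - eta_integral l' \<sigma>)"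

definition magnetic_average :: "real \<Rightarrow> 'm::finite heis set \<Rightarrow> 'm heis set \<Rightarrow> 'm heis set" where
  "magnetic_average r A0 A1 =
     {\<gamma> (r * l) | \<gamma> l. minimizing_magnetic_geodesic l \<gamma> \<and> \<gamma> 0 \<in> A0 \<and> \<gamma> l \<in> A1}"

end

theory Submission imports Defs begin

text \<open>
  The coordinate Gram matrix is unimodular, so the volume is Lebesgue measure. For a curve with planar
  length \<open>L\<close> and \<open>E = \<integral>\<eta>\<close> the action is at least \<open>sqrt (L\<^sup>2 + E\<^sup>2) - E\<close>, and this value is
  attained by spreading the vertical motion proportionally over the same planar projection. A
  minimizer therefore has both halves of equal planar length and equal \<open>\<integral>\<eta>\<close>, which puts the height
  of its midpoint within \<open>O(\<rho>\<^sup>2)\<close> of the average height. Comparing with the straight planar chord,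
  of length \<open>d\<close> and action \<open>c\<close>, bounds \<open>L\<^sup>2 - d\<^sup>2\<close> by \<open>2 * c\<close> times the symplectic area between curve
  and chord; that area is at most the width of the curve around the chord times \<open>(L + d) / 2\<close>, while
  four times the square of the width is at most \<open>L\<^sup>2 - d\<^sup>2\<close>. Hence the width is at most \<open>c * d\<close>. The midpoint of
  the chord lies deeper in the ball by about \<open>d\<^sup>2 / (8 * \<rho>)\<close>, which absorbs the width as soon as the
  end points differ in height by \<open>10 * \<rho>\<^sup>2\<close>. The remaining pairs consist of a point near the top of the lower
  set and one near the bottom of the upper set, so their midpoints lie in a cylinder of radius
  \<open>4 * \<rho>\<close> and height \<open>O(\<rho>\<^sup>2)\<close>, whose volume is \<open>O(\<rho>\<^sup>2 / b)\<close> times that of the given sets.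
\<close>

section \<open>Riemannian volume\<close>

lemma axis_sum:
  "(\<Sum>j\<in>UNIV. f j * (axis i (1::real) $ j)) = f (i::'m::finite)"
  by (simp add: axis_def if_distrib cong: if_cong)

lemma det_heis_gram: "det (heis_gram (p :: 'm::finite heis)) = 1"
proof -
  define r :: "(('m + 'm) + unit) \<Rightarrow> real" where
    "r i = (case i of Inl (Inl j) \<Rightarrow> - (snd (fst p) $ j) | _ \<Rightarrow> 0)" for i
  define z :: "('m + 'm) + unit" where "z = Inr ()"
  define R :: "real ^ (('m + 'm) + unit)" where "R = (\<chi> i. r i)"
  \<comment> \<open>\<open>M\<close> expresses the coframe \<open>dx\<close>, \<open>dy\<close>, \<open>\<eta>\<close> in coordinates, so the Gram matrix is \<open>M\<^sup>T M\<close>.\<close>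
  define M :: "real ^ (('m + 'm) + unit) ^ (('m + 'm) + unit)" where
    "M = (\<chi> k. if k = z then row z (mat 1) + R else row k (mat 1))"
  have rowm: "row k (mat 1 :: real ^ (('m + 'm) + unit) ^ (('m + 'm) + unit)) = axis k 1" for k
    by (auto simp: row_def mat_def axis_def vec_eq_iff)
  have "R = (\<Sum>i\<in>UNIV. r i *s axis i 1)"
    by (simp add: R_def vec_eq_iff axis_def if_distrib cong: if_cong)
  \<comment> \<open>\<open>R\<close> is the \<open>- y dx\<close> part of the contact form and has
    no \<open>z\<close> entry. It is thus a combination of the rows other than \<open>z\<close>, and
    adding it to row \<open>z\<close> leaves the determinant at 1.\<close>
  also have "\<dots> \<in> vec.span {row j (mat 1 :: real ^ (('m + 'm) + unit) ^ (('m + 'm) + unit)) |j. j \<noteq> z}"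
  proof (rule vec.span_sum)
    fix i :: "('m + 'm) + unit"
    show "r i *s axis i 1 \<in> vec.span {row j (mat 1 :: real ^ (('m + 'm) + unit) ^ (('m + 'm) + unit)) |j. j \<noteq> z}"
    proof (cases "i = z")
      case True
      then show ?thesis by (simp add: r_def z_def vec.span_zero)
    next
      case False
      then show ?thesis by (intro vec.span_scale vec.span_base) (auto simp: rowm)
    qed
  qed
  finally have "det M = 1"
    unfolding M_def by (subst det_row_span) auto
  have c1: "M $ Inl k $ i = (if i = Inl k then 1 else 0)" for k i
    by (auto simp: M_def z_def rowm axis_def)
  have c2: "M $ z $ i = (if i = z then 1 else 0) + r i" for i
    by (auto simp: M_def rowm axis_def R_def)
  have split3: "P i" if "\<And>j. P (Inl (Inl j))" "\<And>j. P (Inl (Inr j))" "P z"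
    for P and i :: "('m + 'm) + unit"
    using that unfolding z_def by (metis sum.exhaust old.unit.exhaust)
  have eta: "heis_eta p (heis_coord i) = M $ z $ i" for i
    by (rule split3[of _ i]; simp only: c2; simp add: z_def r_def heis_eta_def axis_sum)
  have x: "fst (fst (heis_coord i)) $ j = M $ Inl (Inl j) $ i" for i j
    by (rule split3[of _ i]; simp only: c1; simp add: z_def axis_def)
  have y: "snd (fst (heis_coord i)) $ j = M $ Inl (Inr j) $ i" for i j
    by (rule split3[of _ i]; simp only: c1; simp add: z_def axis_def)
  have UU: "sum f UNIV = (\<Sum>j\<in>UNIV. f (Inl (Inl j))) + (\<Sum>j\<in>UNIV. f (Inl (Inr j))) + f z"
    for f :: "('m + 'm) + unit \<Rightarrow> real"
    unfolding UNIV_Plus_UNIV[symmetric] by (subst sum.Plus; (subst sum.Plus)?; simp add: z_def UNIV_unit)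
  have "heis_gram p = transpose M ** M"
  proof -
    have "heis_metric p (heis_coord i) (heis_coord j) = (\<Sum>k\<in>UNIV. M $ k $ i * M $ k $ j)" for i j
      by (simp add: UU heis_metric_def x y eta)
    then show ?thesis
      by (simp add: heis_gram_def matrix_matrix_mult_def transpose_def vec_eq_iff)
  qed
  then show ?thesis
    using \<open>det M = 1\<close> by (simp add: det_mul)
qed

lemma heis_volume_eq_lborel: "heis_volume = (lborel :: 'm::finite heis measure)"
  unfolding heis_volume_def det_heis_gram by (simp add: density_1)

lemma Vol_Times:
  assumes "P \<in> sets borel"
  shows "Vol (P \<times> {a..b}) = emeasure lborel (P :: ((real ^ 'm::finite) \<times> (real ^ 'm)) set) * ennreal (b - a)"
proof (cases "a \<le> b")
  case True
  have "P \<times> {a..b} \<in> sets (lborel \<Otimes>\<^sub>M lborel)"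
    using assms by (intro pair_measureI) auto
  then have "outer_measure_of lborel (P \<times> {a..b}) = emeasure (lborel \<Otimes>\<^sub>M lborel) (P \<times> {a..b})"
    unfolding lborel_prod by (rule outer_measure_of_eq)
  also have "\<dots> = emeasure lborel P * emeasure lborel {a..b}"
    using assms by (intro lborel.emeasure_pair_measure_Times) auto
  finally show ?thesis
    using True by (simp add: Vol_def heis_volume_eq_lborel)
next
  case False
  then show ?thesis
    using outer_measure_of_eq[of "{}" "lborel :: 'm heis measure"]
    by (simp add: Vol_def heis_volume_eq_lborel ennreal_neg)
qed

lemma Vol_ball_Times:
  assumes "B = ball 0 r \<or> B = cball (0 :: (real ^ 'm::finite) \<times> (real ^ 'm)) r" "0 \<le> r" "a \<le> b"
  shows "Vol (B \<times> {a..b}) =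
    ennreal (unit_ball_vol (2 * CARD('m)) * r ^ (2 * CARD('m)) * (b - a))"
proof -
  have "emeasure lborel B = ennreal (unit_ball_vol (2 * CARD('m)) * r ^ (2 * CARD('m)))"
  proof -
    have "DIM((real ^ 'm) \<times> (real ^ 'm)) = 2 * CARD('m)" by simp
    then show ?thesis
      using assms(1) emeasure_cball[OF assms(2), of "0 :: (real ^ 'm) \<times> (real ^ 'm)"]
        emeasure_ball[OF assms(2), of "0 :: (real ^ 'm) \<times> (real ^ 'm)"]
      by (elim disjE) (simp_all only:)
  qed
  moreover have "B \<in> sets borel" using assms by auto
  ultimately have "Vol (B \<times> {a..b}) =
      ennreal (unit_ball_vol (2 * CARD('m)) * r ^ (2 * CARD('m))) * ennreal (b - a)"
    by (simp only: Vol_Times)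
  also have "\<dots> = ennreal (unit_ball_vol (2 * CARD('m)) * r ^ (2 * CARD('m)) * (b - a))"
    using assms by (intro ennreal_mult[symmetric] mult_nonneg_nonneg) auto
  finally show ?thesis .
qed

section \<open>Piecewise continuously differentiable curves\<close>

text \<open>Smoothness of a curve is given only between neighbouring break points, so global facts
  are propagated from one break point to the next. The induction counts the points below
  \<open>b\<close>; the predecessor of \<open>b\<close> is their maximum.\<close>

lemma consecutive_induct [consumes 4, case_names first step]:
  fixes T :: "'a::linorder set"
  assumes "finite T" "a \<in> T" "\<And>x. x \<in> T \<Longrightarrow> a \<le> x" "b \<in> T"
    and first: "P a"
    and step: "\<And>c d. \<lbrakk>c \<in> T; d \<in> T; c < d; {c<..<d} \<inter> T = {}; P c\<rbrakk> \<Longrightarrow> P d"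
  shows "P b"
  using \<open>b \<in> T\<close>
proof (induction "card {x \<in> T. x < b}" arbitrary: b rule: less_induct)
  case less
  show ?case
  proof (cases "b = a")
    case False
    define c where "c = Max {x \<in> T. x < b}"
    have fin: "finite {x \<in> T. x < b}" using \<open>finite T\<close> by simp
    have "a \<in> {x \<in> T. x < b}" using False less.prems assms(3)[of b] assms(2) by auto
    then have c: "c \<in> T" "c < b" and max: "\<And>x. x \<in> T \<Longrightarrow> x < b \<Longrightarrow> x \<le> c"
      using Max_in[OF fin] Max_ge[OF fin] unfolding c_def by blast+
    have "{x \<in> T. x < c} \<subset> {x \<in> T. x < b}" using c by auto
    then have "P c" using less.hyps c fin by (simp add: psubset_card_mono)
    moreover have "{c<..<b} \<inter> T = {}" using max by force
    ultimately show ?thesis using step c less.prems by blast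
  qed (simp add: first)
qed

text \<open>Finds the smooth piece that has a given non-break point in its interior.\<close>

lemma consecutive_around:
  fixes T :: "'a::linorder set"
  assumes "finite T" "a \<in> T" "b \<in> T" "a \<le> s" "s \<le> b" "s \<notin> T"
  obtains c d where "c \<in> T" "d \<in> T" "c < s" "s < d" "{c<..<d} \<inter> T = {}"
proof -
  let ?L = "{x \<in> T. x < s}" and ?R = "{x \<in> T. s < x}"
  have fin: "finite ?L" "finite ?R" using assms by auto
  have "a < s" "s < b" using assms by (auto simp: order.order_iff_strict)
  then have ne: "?L \<noteq> {}" "?R \<noteq> {}" using assms by auto
  obtain c where c: "c \<in> T" "c < s" "\<And>x. x \<in> T \<Longrightarrow> x < s \<Longrightarrow> x \<le> c"
    using Max_in[OF fin(1) ne(1)] Max_ge[OF fin(1)] by blast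
  obtain d where d: "d \<in> T" "s < d" "\<And>x. x \<in> T \<Longrightarrow> s < x \<Longrightarrow> d \<le> x"
    using Min_in[OF fin(2) ne(2)] Min_le[OF fin(2)] by blast
  have "x \<notin> T" if "c < x" "x < d" for x
    using c(3)[of x] d(3)[of x] that \<open>s \<notin> T\<close> by (cases x s rule: linorder_cases) auto
  then have "{c<..<d} \<inter> T = {}" by auto
  then show ?thesis by (rule that[OF c(1) d(1) c(2) d(2)])
qed

text \<open>Unit speed says nothing at break points, so pointwise bounds derived from it hold only
  off a finite set; both integrands are replaced by 0 there.\<close>

lemma norm_integral_le_off_finite:
  fixes f :: "real \<Rightarrow> 'a::euclidean_space"
  assumes "finite T" and f: "f integrable_on S" and g: "g integrable_on S"
    and le: "\<And>s. s \<in> S - T \<Longrightarrow> norm (f s) \<le> g s"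
  shows "norm (integral S f) \<le> integral S g"
proof -
  let ?f = "\<lambda>s. if s \<in> T then 0 else f s" and ?g = "\<lambda>s. if s \<in> T then 0 else g s"
  have *: "(?f has_integral integral S f) S" "(?g has_integral integral S g) S"
    using f g \<open>finite T\<close> by (auto intro!: has_integral_spike_finite[OF \<open>finite T\<close> _ integrable_integral])
  have "norm (?f s) \<le> ?g s" if "s \<in> S" for s using le that by simp
  with * have "norm (integral S ?f) \<le> integral S ?g"
    by (intro integral_norm_bound_integral) (auto simp: has_integral_iff)
  moreover have "integral S ?f = integral S f" "integral S ?g = integral S g"
    using * by (auto intro: integral_unique)
  ultimately show ?thesis by simp
qed

lemma integral_eq_off_finite:
  fixes f :: "real \<Rightarrow> 'a::euclidean_space"
  assumes "finite T" "\<And>s. s \<in> S - T \<Longrightarrow> f s = g s"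
  shows "integral S f = integral S g"
proof -
  have "g s = f s" if "s \<in> S - T" for s using assms(2)[OF that] ..
  then show ?thesis by (rule integral_spike[OF negligible_finite[OF assms(1)]])
qed

text \<open>Fixes the partition whose existence \<open>piecewise_C1_curve\<close> asserts, so that
  velocity and line integrals can be treated once for all curves.\<close>

locale C1_pieces =
  fixes l :: real and \<gamma> :: "real \<Rightarrow> 'a::euclidean_space" and T :: "real set"
  assumes nonneg: "0 \<le> l" and cont: "continuous_on {0..l} \<gamma>" and fin: "finite T"
    and zero_in: "0 \<in> T" and end_in: "l \<in> T" and T_sub: "T \<subseteq> {0..l}"
    and pieces: "\<And>c d. \<lbrakk>c \<in> T; d \<in> T; c < d; {c<..<d} \<inter> T = {}\<rbrakk> \<Longrightarrow>
      \<exists>D. continuous_on {c..d} D \<and>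
        (\<forall>s\<in>{c..d}. (\<gamma> has_vector_derivative D s) (at s within {c..d}))"

lemma piecewise_C1_curve_iff: "piecewise_C1_curve l \<gamma> \<longleftrightarrow> (\<exists>T. C1_pieces l \<gamma> T)"
proof -
  have "C1_pieces l \<gamma> T \<longleftrightarrow> 0 \<le> l \<and> continuous_on {0..l} \<gamma> \<and>
      finite T \<and> {0, l} \<subseteq> T \<and> T \<subseteq> {0..l} \<and>
        (\<forall>c\<in>T. \<forall>d\<in>T. c < d \<and> {c<..<d} \<inter> T = {} \<longrightarrow>
           (\<exists>D. continuous_on {c..d} D \<and>
              (\<forall>s\<in>{c..d}. (\<gamma> has_vector_derivative D s) (at s within {c..d}))))" for T
    unfolding C1_pieces_def by blast
  then show ?thesis
    unfolding piecewise_C1_curve_def by (simp only: ex_simps)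
qed

context C1_pieces
begin

definition vel :: "real \<Rightarrow> 'a" where "vel s = vector_derivative \<gamma> (at s)"

lemma piece_vel:
  assumes "c \<in> T" "d \<in> T" "c < d" "{c<..<d} \<inter> T = {}"
  obtains D where "continuous_on {c..d} D"
    "\<And>s. s \<in> {c..d} \<Longrightarrow> (\<gamma> has_vector_derivative D s) (at s within {c..d})"
    "\<And>s. c < s \<Longrightarrow> s < d \<Longrightarrow> D s = vel s"
proof -
  obtain D where D: "continuous_on {c..d} D"
    "\<And>s. s \<in> {c..d} \<Longrightarrow> (\<gamma> has_vector_derivative D s) (at s within {c..d})"
    using pieces[OF assms] by blast
  moreover have "D s = vel s" if "c < s" "s < d" for s
    using D(2)[of s] that unfolding vel_def
    by (metis at_within_Icc_at atLeastAtMost_iff less_imp_le vector_derivative_at)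
  ultimately show ?thesis by (rule that)
qed

lemma has_vel:
  assumes "s \<in> {0..l} - T"
  shows "(\<gamma> has_vector_derivative vel s) (at s)"
proof -
  obtain c d where cd: "c \<in> T" "d \<in> T" "c < s" "s < d" "{c<..<d} \<inter> T = {}"
    using consecutive_around[OF fin zero_in end_in, of s] assms by auto
  then have "c < d" by simp
  then obtain D where D:
    "\<And>s. s \<in> {c..d} \<Longrightarrow> (\<gamma> has_vector_derivative D s) (at s within {c..d})"
    "\<And>s. c < s \<Longrightarrow> s < d \<Longrightarrow> D s = vel s"
    using piece_vel[OF cd(1,2) _ cd(5)] by blast
  then show ?thesis
    using cd D(1)[of s] by (simp add: at_within_Icc_at)
qed

text \<open>At break points \<open>vel\<close> is unspecified, but inside a piece the integrand
  agrees with a function continuous on the closed piece. A general continuous \<open>F\<close>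
  covers the planar speed, the contact form, \<open>y dx\<close> and the vertical velocity of
  competitors.\<close>

lemma vel_integrable_piece:
  assumes F: "continuous_on UNIV (\<lambda>(x, v). F x v :: 'b::euclidean_space)"
    and cd: "c \<in> T" "d \<in> T" "c < d" "{c<..<d} \<inter> T = {}"
  obtains G where "continuous_on {c..d} G" "\<And>s. c < s \<Longrightarrow> s < d \<Longrightarrow> G s = F (\<gamma> s) (vel s)"
proof -
  obtain D where D: "continuous_on {c..d} D" "\<And>s. c < s \<Longrightarrow> s < d \<Longrightarrow> D s = vel s"
    using piece_vel[OF cd] by metis
  have "{c..d} \<subseteq> {0..l}" using cd T_sub by fastforce
  then have "continuous_on {c..d} (\<lambda>s. (\<gamma> s, D s))"
    using D(1) cont by (intro continuous_on_Pair) (auto intro: continuous_on_subset)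
  from continuous_on_compose2[OF F this]
  have "continuous_on {c..d} (\<lambda>s. F (\<gamma> s) (D s))" by simp
  then show ?thesis using that D(2) by simp
qed

lemma vel_integrable:
  assumes F: "continuous_on UNIV (\<lambda>(x, v). F x v :: 'b::euclidean_space)"
  shows "(\<lambda>s. F (\<gamma> s) (vel s)) integrable_on {0..l}"
proof -
  have "(\<lambda>s. F (\<gamma> s) (vel s)) integrable_on {0..b}" if "b \<in> T" for b
  proof (rule consecutive_induct[OF fin zero_in _ that, where P = "\<lambda>b. (\<lambda>s. F (\<gamma> s) (vel s)) integrable_on {0..b}"])
    show "0 \<le> x" if "x \<in> T" for x using that T_sub by auto
    show "(\<lambda>s. F (\<gamma> s) (vel s)) integrable_on {0..0}"
      by (metis box_real(2) integrable_on_refl)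
  next
    fix c d assume step: "c \<in> T" "d \<in> T" "c < d" "{c<..<d} \<inter> T = {}"
      "(\<lambda>s. F (\<gamma> s) (vel s)) integrable_on {0..c}"
    obtain G where G: "continuous_on {c..d} G" "\<And>s. c < s \<Longrightarrow> s < d \<Longrightarrow> G s = F (\<gamma> s) (vel s)"
      using vel_integrable_piece[OF F step(1-4)] by metis
    have "(\<lambda>s. F (\<gamma> s) (vel s)) integrable_on {c..d}"
      by (rule integrable_spike_finite[of "{c, d}" _ _ G])
        (simp_all add: G integrable_continuous_real)
    moreover have "0 \<le> c" using step T_sub by auto
    ultimately show "(\<lambda>s. F (\<gamma> s) (vel s)) integrable_on {0..d}"
      using step by (intro Henstock_Kurzweil_Integration.integrable_combine[of 0 c d]) auto
  qed
  then show ?thesis using end_in .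
qed

lemma vel_integrable_sub:
  assumes "continuous_on UNIV (\<lambda>(x, v). F x v :: 'b::euclidean_space)" "0 \<le> a" "b \<le> l"
  shows "(\<lambda>s. F (\<gamma> s) (vel s)) integrable_on {a..b}"
proof -
  have "{a..b} \<subseteq> {0..l}" using assms(2,3) by auto
  with vel_integrable[OF assms(1)] show ?thesis by (rule integrable_on_subinterval)
qed

text \<open>Passing to the continuous representative \<open>G\<close> gives the one-sided
  derivatives at the ends of the piece as well, which a piecewise C1 competitor must have.\<close>

lemma indef_piece:
  fixes F :: "'a \<Rightarrow> 'a \<Rightarrow> 'b::euclidean_space"
  assumes F: "continuous_on UNIV (\<lambda>(x, v). F x v)"
    and cd: "c \<in> T" "d \<in> T" "c < d" "{c<..<d} \<inter> T = {}"
    and G: "continuous_on {c..d} G" "\<And>s. c < s \<Longrightarrow> s < d \<Longrightarrow> G s = F (\<gamma> s) (vel s)"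
    and s: "s \<in> {c..d}"
  shows "((\<lambda>s. integral {0..s} (\<lambda>u. F (\<gamma> u) (vel u))) has_vector_derivative G s) (at s within {c..d})"
proof -
  let ?f = "\<lambda>u. F (\<gamma> u) (vel u)"
  have c0: "0 \<le> c" and dl: "d \<le> l" using cd T_sub by auto
  have eq: "integral {0..t} ?f = integral {0..c} ?f + integral {c..t} G" if "t \<in> {c..d}" for t
  proof -
    have "integral {0..t} ?f = integral {0..c} ?f + integral {c..t} ?f"
      using that c0 dl by (intro Henstock_Kurzweil_Integration.integral_combine[symmetric] vel_integrable_sub[OF F]) auto
    also have "integral {c..t} ?f = integral {c..t} G"
      by (rule integral_eq_off_finite[of "{c, d}"]) (use that G(2) in auto)
    finally show ?thesis .
  qed
  have "((\<lambda>t. integral {0..c} ?f + integral {c..t} G) has_vector_derivative G s) (at s within {c..d})"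
    using has_vector_derivative_add[OF has_vector_derivative_const integral_has_vector_derivative[OF G(1) s]]
    by simp
  then show ?thesis
    by (rule has_vector_derivative_transform[OF s, rotated]) (rule eq)
qed

lemma indef_has_derivative:
  fixes F :: "'a \<Rightarrow> 'a \<Rightarrow> 'b::euclidean_space"
  assumes F: "continuous_on UNIV (\<lambda>(x, v). F x v)" and "s \<in> {0..l} - T"
  shows "((\<lambda>s. integral {0..s} (\<lambda>u. F (\<gamma> u) (vel u))) has_vector_derivative F (\<gamma> s) (vel s)) (at s)"
proof -
  obtain c d where cd: "c \<in> T" "d \<in> T" "c < s" "s < d" "{c<..<d} \<inter> T = {}"
    using consecutive_around[OF fin zero_in end_in, of s] assms by auto
  then have "c < d" by simp
  obtain G where G: "continuous_on {c..d} G" "\<And>s. c < s \<Longrightarrow> s < d \<Longrightarrow> G s = F (\<gamma> s) (vel s)"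
    using vel_integrable_piece[OF F cd(1,2) \<open>c < d\<close> cd(5)] by metis
  show ?thesis
    using indef_piece[OF F cd(1,2) \<open>c < d\<close> cd(5) G, of s] cd G(2)[of s]
    by (simp add: at_within_Icc_at)
qed

text \<open>The source of competitors: with \<open>A = fst\<close> the planar projection is kept
  while the vertical velocity \<open>F\<close> is chosen freely, and the old partition still
  serves.\<close>

lemma extend_indef:
  fixes F :: "'a \<Rightarrow> 'a \<Rightarrow> 'b::euclidean_space" and A :: "'a \<Rightarrow> 'c::euclidean_space"
  assumes F: "continuous_on UNIV (\<lambda>(x, v). F x v)" and A: "bounded_linear A"
  shows "C1_pieces l (\<lambda>s. (A (\<gamma> s), w + integral {0..s} (\<lambda>u. F (\<gamma> u) (vel u)))) T"
proof
  show "continuous_on {0..l} (\<lambda>s. (A (\<gamma> s), w + integral {0..s} (\<lambda>u. F (\<gamma> u) (vel u))))"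
    by (intro continuous_intros indefinite_integral_continuous_1 vel_integrable[OF F]
        bounded_linear.continuous_on[OF A] cont)
next
  fix c d assume cd: "c \<in> T" "d \<in> T" "c < d" "{c<..<d} \<inter> T = {}"
  obtain D where D: "continuous_on {c..d} D"
    "\<And>s. s \<in> {c..d} \<Longrightarrow> (\<gamma> has_vector_derivative D s) (at s within {c..d})"
    using piece_vel[OF cd] by metis
  obtain G where G: "continuous_on {c..d} G" "\<And>s. c < s \<Longrightarrow> s < d \<Longrightarrow> G s = F (\<gamma> s) (vel s)"
    using vel_integrable_piece[OF F cd] by metis
  have "((\<lambda>s. (A (\<gamma> s), w + integral {0..s} (\<lambda>u. F (\<gamma> u) (vel u)))) has_vector_derivative
      (A (D s), 0 + G s)) (at s within {c..d})" if "s \<in> {c..d}" for s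
    using that by (intro has_vector_derivative_Pair has_vector_derivative_add has_vector_derivative_const
        bounded_linear.has_vector_derivative[OF A] D(2) indef_piece[OF F cd G])
  moreover have "continuous_on {c..d} (\<lambda>s. (A (D s), 0 + G s))"
    by (intro continuous_intros bounded_linear.continuous_on[OF A] D(1) G(1))
  ultimately show "\<exists>D. continuous_on {c..d} D \<and> (\<forall>s\<in>{c..d}.
      ((\<lambda>s. (A (\<gamma> s), w + integral {0..s} (\<lambda>u. F (\<gamma> u) (vel u)))) has_vector_derivative D s) (at s within {c..d}))"
    by blast
qed (rule nonneg fin zero_in end_in T_sub)+

end

section \<open>Planar projection and competitors\<close>

lemma heis_eta_eq: "heis_eta p v = snd v - snd (fst p) \<bullet> fst (fst v)"
  by (simp add: heis_eta_def inner_vec_def)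

lemma heis_norm_eq: "heis_norm p v = sqrt ((norm (fst v))\<^sup>2 + (heis_eta p v)\<^sup>2)"
proof -
  have "(norm (fst v))\<^sup>2 = fst (fst v) \<bullet> fst (fst v) + snd (fst v) \<bullet> snd (fst v)"
    by (simp add: power2_norm_eq_inner inner_prod_def)
  then show ?thesis
    by (simp add: heis_norm_def heis_metric_def inner_vec_def power2_eq_square)
qed

text \<open>Over the segment from \<open>P\<close> to \<open>Q\<close> the integral of
  \<open>y dx\<close> is the trapezoidal value subtracted in \<open>k\<close>. The lift is chosen
  with the contact form constantly equal to \<open>k\<close>, so the speed is constant too.\<close>

lemma straight_competitor:
  fixes P Q :: "(real ^ 'm::finite) \<times> (real ^ 'm)" and z0 z1 :: real
  defines "k \<equiv> z1 - z0 - (snd P + snd Q) \<bullet> (fst Q - fst P) / 2"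
  obtains \<sigma> where "piecewise_C1_curve 1 \<sigma>" "\<sigma> 0 = (P, z0)" "\<sigma> 1 = (Q, z1)"
    "heis_length 1 \<sigma> - eta_integral 1 \<sigma> = sqrt ((norm (Q - P))\<^sup>2 + k\<^sup>2) - k"
proof
  \<comment> \<open>Along the segment \<open>y dx\<close> grows linearly with slope
    \<open>v\<close>; the vertical velocity \<open>u + s * v\<close> exceeds it by exactly
    \<open>k\<close>.\<close>
  define u where "u = snd P \<bullet> (fst Q - fst P) + k"
  define v where "v = (snd Q - snd P) \<bullet> (fst Q - fst P)"
  define \<sigma> where "\<sigma> s = (P + s *\<^sub>R (Q - P), z0 + s * u + s\<^sup>2 / 2 * v)" for s
  have der: "(\<sigma> has_vector_derivative (Q - P, u + s * v)) (at s within S)" for s S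
    unfolding \<sigma>_def
    by (auto intro!: derivative_eq_intros has_vector_derivative_Pair
        simp: has_real_derivative_iff_has_vector_derivative[symmetric])
  show "piecewise_C1_curve 1 \<sigma>"
    unfolding piecewise_C1_curve_def
  proof (intro conjI exI[of _ "{0, 1}"] ballI impI)
    show "continuous_on {0..1} \<sigma>"
      unfolding \<sigma>_def by (intro continuous_intros) auto
    fix c d :: real
    show "\<exists>D. continuous_on {c..d} D \<and> (\<forall>s\<in>{c..d}. (\<sigma> has_vector_derivative D s) (at s within {c..d}))"
      by (intro exI[of _ "\<lambda>s. (Q - P, u + s * v)"] conjI ballI der continuous_intros)
  qed auto
  show "\<sigma> 0 = (P, z0)" by (simp add: \<sigma>_def)
  show "\<sigma> 1 = (Q, z1)"
    by (simp add: \<sigma>_def u_def v_def k_def inner_diff_left inner_add_left field_simps)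
  have vd: "vector_derivative \<sigma> (at s) = (Q - P, u + s * v)" for s
    by (rule vector_derivative_at[OF der])
  have eta: "heis_eta (\<sigma> s) (Q - P, u + s * v) = k" for s
    by (simp add: heis_eta_eq \<sigma>_def u_def v_def inner_add_left)
  show "heis_length 1 \<sigma> - eta_integral 1 \<sigma> = sqrt ((norm (Q - P))\<^sup>2 + k\<^sup>2) - k"
    by (simp add: heis_length_def eta_integral_def vd heis_norm_eq eta)
qed

text \<open>Stewart's theorem in an inner product space.\<close>

lemma norm_diff_segment_power2:
  fixes x p q :: "'a::real_inner"
  shows "(norm (x - (p + t *\<^sub>R (q - p))))\<^sup>2 =
    (1 - t) * (norm (x - p))\<^sup>2 + t * (norm (x - q))\<^sup>2 - t * (1 - t) * (norm (q - p))\<^sup>2"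
  unfolding power2_norm_eq_inner
  by (simp add: inner_diff_left inner_diff_right inner_add_left inner_add_right algebra_simps
      inner_commute power2_eq_square)

locale heis_curve = C1_pieces l \<gamma> T for l and \<gamma> :: "real \<Rightarrow> 'm::finite heis" and T
begin

text \<open>Planar projection, planar speed, the contact form and \<open>y dx\<close> evaluated on
  the velocity, planar arc length, and the distance between the planar end points.\<close>

definition p :: "real \<Rightarrow> (real ^ 'm) \<times> (real ^ 'm)" where "p s = fst (\<gamma> s)"
definition h :: "real \<Rightarrow> real" where "h s = norm (fst (vel s))"
definition eta :: "real \<Rightarrow> real" where "eta s = heis_eta (\<gamma> s) (vel s)"
definition ydx :: "real \<Rightarrow> real" where "ydx s = snd (p s) \<bullet> fst (fst (vel s))"
definition arc :: "real \<Rightarrow> real" where "arc s = integral {0..s} h"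
definition chord :: real where "chord = norm (p l - p 0)"

lemma p_cont: "continuous_on {0..l} p"
  unfolding p_def by (intro continuous_intros cont)

lemma h_cont: "continuous_on UNIV (\<lambda>(g :: 'm heis, v :: 'm heis). norm (fst v))"
  unfolding case_prod_beta by (intro continuous_intros)

lemma eta_cont: "continuous_on UNIV (\<lambda>(g :: 'm heis, v :: 'm heis). heis_eta g v)"
  unfolding case_prod_beta heis_eta_eq by (intro continuous_intros)

lemma ydx_cont: "continuous_on UNIV (\<lambda>(g :: 'm heis, v :: 'm heis). snd (fst g) \<bullet> fst (fst v))"
  unfolding case_prod_beta by (intro continuous_intros)

lemma integrable:
  assumes "0 \<le> a" "b \<le> l"
  shows "h integrable_on {a..b}" "eta integrable_on {a..b}" "ydx integrable_on {a..b}"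
  using vel_integrable_sub[OF h_cont assms] vel_integrable_sub[OF eta_cont assms]
    vel_integrable_sub[OF ydx_cont assms]
  by (simp_all only: h_def[abs_def] eta_def[abs_def] ydx_def[abs_def] p_def)

lemma h_nonneg: "0 \<le> h s" by (simp add: h_def)

lemma vel_has_integral:
  assumes "0 \<le> a" "a \<le> b" "b \<le> l"
  shows "(vel has_integral \<gamma> b - \<gamma> a) {a..b}"
proof (rule fundamental_theorem_of_calculus_interior_strong[OF fin assms(2)])
  show "(\<gamma> has_vector_derivative vel s) (at s)" if "s \<in> {a<..<b} - T" for s
    using that assms by (intro has_vel) auto
  show "continuous_on {a..b} \<gamma>"
    using cont by (rule continuous_on_subset) (use assms in auto)
qed

lemma planar_displacement_le:
  assumes "0 \<le> a" "a \<le> b" "b \<le> l"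
  shows "norm (p b - p a) \<le> integral {a..b} h"
proof -
  have "((\<lambda>s. fst (vel s)) has_integral fst (\<gamma> b - \<gamma> a)) {a..b}"
    using has_integral_linear[OF vel_has_integral[OF assms] bounded_linear_fst] by (simp add: o_def)
  then have "p b - p a = integral {a..b} (\<lambda>s. fst (vel s))" "(\<lambda>s. fst (vel s)) integrable_on {a..b}"
    by (auto simp: p_def integral_unique)
  then show ?thesis
    using integral_norm_bound_integral[of "\<lambda>s. fst (vel s)" "{a..b}" h] integrable(1)[of a b] assms
    by (simp add: h_def)
qed

text \<open>Along the curve \<open>dz\<close> is the contact form plus \<open>y dx\<close>.\<close>

lemma height_eq:
  assumes "0 \<le> a" "a \<le> b" "b \<le> l"
  shows "snd (\<gamma> b) - snd (\<gamma> a) = integral {a..b} eta + integral {a..b} ydx"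
proof -
  have "((\<lambda>s. snd (vel s)) has_integral snd (\<gamma> b - \<gamma> a)) {a..b}"
    using has_integral_linear[OF vel_has_integral[OF assms] bounded_linear_snd] by (simp add: o_def)
  moreover have "snd (vel s) = eta s + ydx s" for s
    by (simp add: eta_def ydx_def heis_eta_eq p_def)
  moreover have "((\<lambda>s. eta s + ydx s) has_integral integral {a..b} eta + integral {a..b} ydx) {a..b}"
    using integrable[OF assms(1,3)] by (intro has_integral_add) (auto simp: has_integral_integral)
  ultimately show ?thesis by (auto dest: has_integral_unique)
qed

lemma arc_split:
  assumes "0 \<le> s" "s \<le> l"
  shows "integral {s..l} h = arc l - arc s"
  using Henstock_Kurzweil_Integration.integral_combine[OF assms integrable(1)[of 0 l]]
  by (simp add: arc_def)

lemma arc_mono: "0 \<le> arc s" "\<lbrakk>0 \<le> s; s \<le> l\<rbrakk> \<Longrightarrow> arc s \<le> arc l"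
proof -
  \<comment> \<open>\<open>integral\<close> is 0 for non-integrable functions, which gives
    nonnegativity for every \<open>s\<close>.\<close>
  show "0 \<le> arc s" unfolding arc_def by (cases "h integrable_on {0..s}")
      (simp_all add: integral_nonneg h_nonneg not_integrable_integral)
  show "arc s \<le> arc l" if "0 \<le> s" "s \<le> l"
    using integral_nonneg[OF integrable(1)[of s l]] h_nonneg that
    by (simp add: arc_split)
qed

lemma arc_zero [simp]: "arc 0 = 0" by (simp add: arc_def)

lemma chord_le: "chord \<le> arc l" "0 \<le> chord"
  using planar_displacement_le[of 0 l] nonneg by (simp_all add: chord_def arc_def)

lemma arc_has_derivative:
  assumes "s \<in> {0..l} - T"
  shows "(arc has_real_derivative h s) (at s)"
  using indef_has_derivative[OF h_cont assms]
  by (simp add: has_real_derivative_iff_has_vector_derivative arc_def[abs_def] h_def[abs_def])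

lemma arc_continuous: "continuous_on {0..l} arc"
  unfolding arc_def[abs_def] by (rule indefinite_integral_continuous_1[OF integrable(1)]) simp_all

text \<open>Redistributing the vertical part proportionally to planar arc length keeps the planar
  projection and needs no reparametrization.\<close>

lemma proportional_competitor:
  obtains \<sigma> where "piecewise_C1_curve l \<sigma>" "\<sigma> 0 = \<gamma> 0"
    "\<sigma> l = (p l, snd (\<gamma> 0) + integral {0..l} ydx + k * arc l)"
    "heis_length l \<sigma> - eta_integral l \<sigma> = (sqrt (1 + k\<^sup>2) - k) * arc l"
proof
  \<comment> \<open>The vertical velocity for which the contact form equals \<open>k\<close> times
    the planar speed.\<close>
  define F where "F g v = snd (fst g) \<bullet> fst (fst v) + k * norm (fst v)" for g v :: "'m heis"
  have F: "continuous_on UNIV (\<lambda>(g, v). F g v)"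
    unfolding case_prod_beta F_def by (intro continuous_intros)
  define \<sigma> where "\<sigma> s = (fst (\<gamma> s), snd (\<gamma> 0) + integral {0..s} (\<lambda>u. F (\<gamma> u) (vel u)))" for s
  have "C1_pieces l \<sigma> T"
    unfolding \<sigma>_def[abs_def] by (rule extend_indef[OF F bounded_linear_fst])
  then show "piecewise_C1_curve l \<sigma>" using piecewise_C1_curve_iff by blast
  show "\<sigma> 0 = \<gamma> 0" by (simp add: \<sigma>_def)
  have "integral {0..l} (\<lambda>u. F (\<gamma> u) (vel u)) = integral {0..l} (\<lambda>u. ydx u + k * h u)"
    by (simp add: F_def ydx_def h_def p_def)
  also have "\<dots> = integral {0..l} ydx + k * arc l"
    using integrable[of 0 l] by (subst integral_add) (simp_all add: arc_def integrable_on_mult_right)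
  finally show "\<sigma> l = (p l, snd (\<gamma> 0) + integral {0..l} ydx + k * arc l)"
    by (simp add: \<sigma>_def p_def)
  have vd: "vector_derivative \<sigma> (at s) = (fst (vel s), F (\<gamma> s) (vel s))" if "s \<in> {0..l} - T" for s
  proof (rule vector_derivative_at)
    have "(\<sigma> has_vector_derivative (fst (vel s), 0 + F (\<gamma> s) (vel s))) (at s)"
      unfolding \<sigma>_def[abs_def]
      by (intro has_vector_derivative_Pair has_vector_derivative_add has_vector_derivative_const
          bounded_linear.has_vector_derivative[OF bounded_linear_fst] has_vel indef_has_derivative[OF F] that)
    then show "(\<sigma> has_vector_derivative (fst (vel s), F (\<gamma> s) (vel s))) (at s)" by simp
  qed
  have e: "heis_eta (\<sigma> s) (fst (vel s), F (\<gamma> s) (vel s)) = k * h s" for s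
    by (simp add: heis_eta_eq \<sigma>_def F_def h_def)
  have "heis_norm (\<sigma> s) (fst (vel s), F (\<gamma> s) (vel s)) = sqrt (1 + k\<^sup>2) * h s" for s
  proof -
    have "(h s)\<^sup>2 + (k * h s)\<^sup>2 = (1 + k\<^sup>2) * (h s)\<^sup>2" by (simp add: power_mult_distrib algebra_simps)
    then show ?thesis
      using h_nonneg[of s] by (simp add: heis_norm_eq e real_sqrt_mult flip: h_def)
  qed
  then have "heis_length l \<sigma> = integral {0..l} (\<lambda>s. sqrt (1 + k\<^sup>2) * h s)"
    unfolding heis_length_def by (intro integral_eq_off_finite[OF fin]) (simp add: vd)
  moreover have "eta_integral l \<sigma> = integral {0..l} (\<lambda>s. k * h s)"
    unfolding eta_integral_def by (intro integral_eq_off_finite[OF fin]) (simp add: vd e)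
  ultimately show "heis_length l \<sigma> - eta_integral l \<sigma> = (sqrt (1 + k\<^sup>2) - k) * arc l"
    by (simp add: arc_def algebra_simps)
qed

text \<open>The point of the chord that divides it in the ratio in which \<open>p s\<close> divides
  the planar arc length. For \<open>arc l = 0\<close> division by zero yields
  \<open>p 0\<close>.\<close>

definition shadow :: "real \<Rightarrow> (real ^ 'm) \<times> (real ^ 'm)" where
  "shadow s = p 0 + (arc s / arc l) *\<^sub>R (p l - p 0)"

text \<open>Stewart's theorem with the two distances to the end points bounded by arc lengths, and
  \<open>t * (1 - t) \<le> 1 / 4\<close>. The bound is the semi-minor axis of the ellipse with foci
  at the end points and major axis \<open>arc l\<close>.\<close>

lemma shadow_dist:
  assumes "0 \<le> s" "s \<le> l"
  shows "norm (p s - shadow s) \<le> sqrt ((arc l)\<^sup>2 - chord\<^sup>2) / 2"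
proof (cases "arc l = 0")
  case True
  then have "norm (p s - p 0) \<le> 0"
    using planar_displacement_le[of 0 s] arc_mono[of s] assms by (simp add: arc_def)
  then show ?thesis using True chord_le by (simp add: shadow_def)
next
  case False
  define t where "t = arc s / arc l"
  have L: "0 < arc l" using False arc_mono(1)[of l] by simp
  have t: "0 \<le> t" "t \<le> 1" "arc s = t * arc l"
    using arc_mono[of s] assms L by (auto simp: t_def)
  have "norm (p s - p 0) \<le> t * arc l"
    using planar_displacement_le[of 0 s] assms t by (simp add: arc_def)
  then have 1: "(norm (p s - p 0))\<^sup>2 \<le> (t * arc l)\<^sup>2" by (rule power_mono) simp
  have "norm (p s - p l) \<le> (1 - t) * arc l"
    using planar_displacement_le[of s l] assms t
    by (simp add: arc_split norm_minus_commute algebra_simps)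
  then have 2: "(norm (p s - p l))\<^sup>2 \<le> ((1 - t) * arc l)\<^sup>2" by (rule power_mono) simp
  have "(norm (p s - shadow s))\<^sup>2 \<le> (1 - t) * (t * arc l)\<^sup>2 + t * ((1 - t) * arc l)\<^sup>2 - t * (1 - t) * chord\<^sup>2"
    unfolding shadow_def t_def[symmetric] norm_diff_segment_power2 chord_def
    using t 1 2 by (intro diff_right_mono add_mono mult_left_mono) auto
  also have "\<dots> = t * (1 - t) * ((arc l)\<^sup>2 - chord\<^sup>2)" by algebra
  also have "\<dots> \<le> (1 / 4) * ((arc l)\<^sup>2 - chord\<^sup>2)"
  proof (rule mult_right_mono)
    have "0 \<le> (t - 1 / 2)\<^sup>2" by simp
    then show "t * (1 - t) \<le> 1 / 4" by (simp add: power2_eq_square algebra_simps)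
    show "0 \<le> (arc l)\<^sup>2 - chord\<^sup>2" using chord_le by (simp add: power_mono)
  qed
  finally have "norm (p s - shadow s) \<le> sqrt ((1 / 4) * ((arc l)\<^sup>2 - chord\<^sup>2))"
    by (rule real_le_rsqrt)
  then show ?thesis by (simp add: real_sqrt_mult real_sqrt_divide)
qed

end

section \<open>Symplectic area and deviation from the chord\<close>

text \<open>The symplectic form is the inner product with the image of \<open>u\<close> under an
  isometric complex structure, so Cauchy-Schwarz applies.\<close>

lemma symplectic_le_norm:
  fixes u v :: "'a::real_inner \<times> 'a"
  shows "\<bar>snd u \<bullet> fst v - fst u \<bullet> snd v\<bar> \<le> norm u * norm v"
proof -
  have "snd u \<bullet> fst v - fst u \<bullet> snd v = (snd u, - fst u) \<bullet> v"
    by (simp add: inner_prod_def)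
  moreover have "norm (snd u, - fst u) = norm u"
    by (simp add: norm_prod_def add.commute)
  ultimately show ?thesis
    using Cauchy_Schwarz_ineq2[of "(snd u, - fst u)" v] by simp
qed

text \<open>Here \<open>c\<close> is the action of the straight competitor, \<open>L\<close> and \<open>d\<close> are the planar length and
  chord, and \<open>W\<close> bounds the deviation from the chord. The area estimate makes \<open>W\<close> linear
  in \<open>c\<close>; without it, the ellipse with foci at the
  end points would only give order \<open>sqrt c\<close>.\<close>

lemma bulge_bounds:
  fixes d L E E0 l c W \<rho> :: real
  assumes d: "0 \<le> d" "d \<le> L" "d \<le> 2 * \<rho>" and \<rho>: "0 < \<rho>" "\<rho> \<le> 1" and E0: "\<rho>\<^sup>2 \<le> E0"
    and c: "c = sqrt (d\<^sup>2 + E0\<^sup>2) - E0" and l: "0 \<le> l" "l \<le> c + E" "L\<^sup>2 + E\<^sup>2 \<le> l\<^sup>2"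
    and W: "W = sqrt (L\<^sup>2 - d\<^sup>2) / 2" and area: "E - E0 \<le> W * (L + d) / 2"
  shows "0 \<le> c" "2 * c * E0 \<le> d\<^sup>2" "c \<le> 5 / 4" "W \<le> c * d" "L \<le> 3 * d"
proof -
  have E0': "0 \<le> E0" using E0 by (meson order_trans zero_le_power2)
  have "sqrt (E0\<^sup>2) \<le> sqrt (d\<^sup>2 + E0\<^sup>2)" by simp
  then show c0: "0 \<le> c" using E0' c by simp
  have "(c + E0)\<^sup>2 = d\<^sup>2 + E0\<^sup>2" using c by simp
  then have cE: "c\<^sup>2 + 2 * c * E0 = d\<^sup>2" by (simp add: power2_eq_square algebra_simps)
  then show "2 * c * E0 \<le> d\<^sup>2" by (metis le_add_same_cancel2 zero_le_power2)
  \<comment> \<open>If \<open>c > 5 / 4\<close>, then \<open>cE\<close> gives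
    \<open>d\<^sup>2 > 25 / 16 + 5 / 2 * \<rho>\<^sup>2\<close>. Since
    \<open>\<rho> \<le> 1\<close>, this contradicts
    \<open>d\<^sup>2 \<le> 4 * \<rho>\<^sup>2\<close>.\<close>
  show c54: "c \<le> 5 / 4"
  proof (rule ccontr)
    assume "\<not> c \<le> 5 / 4"
    then have "5 / 4 < c" by simp
    have "\<rho>\<^sup>2 \<le> 1" using \<rho> by (simp add: power_le_one)
    have "d\<^sup>2 \<le> (2 * \<rho>)\<^sup>2" using d by (intro power_mono) auto
    moreover have "(5 / 4)\<^sup>2 < c\<^sup>2" using \<open>5 / 4 < c\<close> by (intro power_strict_mono) auto
    moreover have "2 * (5 / 4) * \<rho>\<^sup>2 \<le> 2 * c * E0"
      using \<open>5 / 4 < c\<close> E0 by (intro mult_mono) auto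
    ultimately have "(5 / 4)\<^sup>2 + 2 * (5 / 4) * \<rho>\<^sup>2 < (2 * \<rho>)\<^sup>2" using cE by linarith
    then show False using \<open>\<rho>\<^sup>2 \<le> 1\<close> by (simp add: power2_eq_square)
  qed
  have W0: "0 \<le> W" and W4: "4 * W\<^sup>2 = L\<^sup>2 - d\<^sup>2"
    using d by (simp_all add: W power_mono power_divide)
  \<comment> \<open>Squaring \<open>l \<le> c + E\<close> cancels \<open>E\<^sup>2\<close>;
    subtracting \<open>cE\<close> leaves the excess \<open>L\<^sup>2 - d\<^sup>2\<close> controlled
    by \<open>E - E0\<close>, to which the area bound applies.\<close>
  have "L\<^sup>2 \<le> (c + E)\<^sup>2 - E\<^sup>2" using l power_mono[of l "c + E" 2] by linarith
  also have "\<dots> = c\<^sup>2 + 2 * c * E" by (simp add: power2_eq_square algebra_simps)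
  finally have "L\<^sup>2 - d\<^sup>2 \<le> 2 * c * (E - E0)" using cE by (simp add: algebra_simps)
  also have "\<dots> \<le> 2 * c * (W * (L + d) / 2)" using area c0 by (intro mult_left_mono) auto
  finally have key: "L\<^sup>2 - d\<^sup>2 \<le> c * W * (L + d)" by simp
  have "W \<le> c * d \<and> L \<le> 3 * d"
  proof (cases "W = 0")
    case True
    then have "L\<^sup>2 = d\<^sup>2" using W4 by simp
    then have "L = d" using d by simp
    then show ?thesis using True c0 d by simp
  next
    case False
    then have Wp: "0 < W" using W0 by simp
    have "W * (4 * W) \<le> W * (c * (L + d))"
      using key W4 by (simp add: power2_eq_square mult_ac)
    then have W1: "4 * W \<le> c * (L + d)" using Wp by simp
    have "L \<noteq> 0"
    proof
      assume "L = 0"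
      moreover from this have "d = 0" using d by simp
      ultimately show False using W4 False by simp
    qed
    then have Ld: "0 < L + d" using d by simp
    have "(L - d) * (L + d) \<le> (c * W) * (L + d)"
      using key by (simp add: power2_eq_square algebra_simps)
    \<comment> \<open>Inserting \<open>W1\<close> and \<open>c \<le> 5 / 4\<close> yields
      \<open>L - d \<le> 25 / 64 * (L + d)\<close>, that is \<open>L \<le> 89 / 39 * d\<close>,
      which is below \<open>3 * d\<close>.\<close>
    then have "L - d \<le> c * W" using Ld by (simp only: mult_le_cancel_right_pos)
    also have "\<dots> \<le> c * (c * (L + d) / 4)" using W1 c0 by (intro mult_left_mono) auto
    also have "\<dots> = (c * c) * ((L + d) / 4)" by simp
    also have "\<dots> \<le> (5 / 4 * (5 / 4)) * ((L + d) / 4)"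
      using c0 c54 Ld by (intro mult_right_mono mult_mono) auto
    finally have L3: "L \<le> 3 * d" using d by simp
    have "c * (L + d) \<le> c * (4 * d)" using L3 c0 by (intro mult_left_mono) auto
    then show ?thesis using W1 L3 by simp
  qed
  then show "W \<le> c * d" "L \<le> 3 * d" by auto
qed

context heis_curve
begin

lemma ydx_bound:
  assumes ab: "0 \<le> a" "a \<le> b" "b \<le> l" and R: "\<And>s. s \<in> {a..b} \<Longrightarrow> norm (p s) \<le> R"
  shows "\<bar>integral {a..b} ydx\<bar> \<le> R * integral {a..b} h"
proof -
  have "norm (integral {a..b} ydx) \<le> integral {a..b} (\<lambda>s. R * h s)"
  proof (rule integral_norm_bound_integral)
    show "ydx integrable_on {a..b}" "(\<lambda>s. R * h s) integrable_on {a..b}"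
      using integrable[OF ab(1,3)] by (auto intro: integrable_on_mult_right)
    fix s assume s: "s \<in> {a..b}"
    have "norm (ydx s) \<le> norm (snd (p s)) * norm (fst (fst (vel s)))"
      using Cauchy_Schwarz_ineq2 by (simp add: ydx_def)
    also have "\<dots> \<le> norm (p s) * h s"
      using norm_snd_le[of "snd (p s)" "fst (p s)"] norm_fst_le[of "fst (fst (vel s))" "snd (fst (vel s))"]
      unfolding h_def by (intro mult_mono) auto
    also have "\<dots> \<le> R * h s" using R[OF s] h_nonneg by (intro mult_right_mono) auto
    finally show "norm (ydx s) \<le> R * h s" .
  qed
  then show ?thesis by simp
qed

lemma p_has_derivative:
  assumes "s \<in> {0..l} - T"
  shows "(p has_vector_derivative fst (vel s)) (at s)"
  unfolding p_def[abs_def]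
  by (intro bounded_linear.has_vector_derivative[OF bounded_linear_fst] has_vel assms)

lemma shadow_ends:
  assumes "arc l \<noteq> 0" shows "shadow 0 = p 0" "shadow l = p l"
  using assms by (simp_all add: shadow_def)

text \<open>The symplectic area between curve and shadow is half the integral of
  \<open>\<omega>(p - shadow, p' + shadow')\<close>, up to a boundary term that vanishes at both ends.\<close>

lemma area_between_curve_and_chord:
  "\<bar>integral {0..l} ydx - (snd (p 0) + snd (p l)) \<bullet> (fst (p l) - fst (p 0)) / 2\<bar>
    \<le> sqrt ((arc l)\<^sup>2 - chord\<^sup>2) / 2 * (arc l + chord) / 2"
proof (cases "arc l = 0")
  \<comment> \<open>Zero planar length makes the projection constant; both the chord and the
    integral of \<open>y dx\<close> vanish.\<close>
  case True
  have eq: "p s = p 0" if "0 \<le> s" "s \<le> l" for s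
    using planar_displacement_le[of 0 s] arc_mono[of s] that True by (simp add: arc_def)
  have "\<bar>integral {0..l} ydx\<bar> \<le> norm (p 0) * integral {0..l} h"
  proof (rule ydx_bound)
    fix s assume "s \<in> {0..l}"
    then have "p s = p 0" by (intro eq) simp_all
    then show "norm (p s) \<le> norm (p 0)" by (rule arg_cong[THEN order_eq_refl])
  qed (simp_all add: nonneg)
  moreover have "p l = p 0" using nonneg by (intro eq) simp_all
  ultimately show ?thesis using True chord_le by (simp add: arc_def)
next
  case False
  define L where "L = arc l"
  have L: "0 < L" using False arc_mono(1)[of l] by (simp add: L_def)
  define W where "W = sqrt (L\<^sup>2 - chord\<^sup>2) / 2"
  define \<Delta> where "\<Delta> = p l - p 0"
  \<comment> \<open>The first two terms are the primitive of \<open>y dx\<close> along the shadow;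
    the last is the boundary term, zero where \<open>p\<close> meets \<open>shadow\<close>.\<close>
  define \<psi> where "\<psi> s = (snd (p 0) \<bullet> fst \<Delta>) * (arc s / L) + (snd \<Delta> \<bullet> fst \<Delta>) / 2 * (arc s / L)\<^sup>2
    + (fst (p s) - fst (shadow s)) \<bullet> (snd (p s) + snd (shadow s)) / 2" for s
  define v where "v s = (h s / L) *\<^sub>R \<Delta> + fst (vel s)" for s
  define g where "g s = (snd (p s - shadow s) \<bullet> fst (v s) - fst (p s - shadow s) \<bullet> snd (v s)) / 2" for s
  have sh: "shadow s = p 0 + (arc s / L) *\<^sub>R \<Delta>" for s by (simp add: shadow_def L_def \<Delta>_def)
  have der: "(\<psi> has_vector_derivative ydx s - g s) (at s)" if s: "s \<in> {0..l} - T" for s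
  proof -
    have a: "((\<lambda>s. arc s / L) has_vector_derivative h s / L) (at s)"
      using DERIV_cdivide[OF arc_has_derivative[OF s]]
      by (simp add: has_real_derivative_iff_has_vector_derivative)
    have dsh: "(shadow has_vector_derivative (h s / L) *\<^sub>R \<Delta>) (at s)"
      unfolding sh[abs_def]
      using has_vector_derivative_add[OF has_vector_derivative_const
          bounded_linear.has_vector_derivative[OF bounded_linear_scaleR_left a]] by simp
    note dp = p_has_derivative[OF s]
    have d1: "((\<lambda>s. fst (p s) - fst (shadow s)) has_vector_derivative fst (fst (vel s)) - fst ((h s / L) *\<^sub>R \<Delta>)) (at s)"
      by (intro has_vector_derivative_diff bounded_linear.has_vector_derivative[OF bounded_linear_fst] dp dsh)
    have d2: "((\<lambda>s. snd (p s) + snd (shadow s)) has_vector_derivative snd (fst (vel s)) + snd ((h s / L) *\<^sub>R \<Delta>)) (at s)"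
      by (intro has_vector_derivative_add bounded_linear.has_vector_derivative[OF bounded_linear_snd] dp dsh)
    note d3 = bounded_bilinear.has_vector_derivative[OF bounded_bilinear_inner d1 d2]
    have "((\<lambda>s. A * \<tau> s + B * (\<tau> s)\<^sup>2 + K s / 2) has_real_derivative A * \<tau>' + B * (2 * \<tau> s * \<tau>') + K' / 2) (at s)"
      if "(\<tau> has_real_derivative \<tau>') (at s)" "(K has_real_derivative K') (at s)"
      for \<tau> K and A B \<tau>' K' :: real
      by (auto intro!: derivative_eq_intros that)
    from this[OF a[folded has_real_derivative_iff_has_vector_derivative]
        d3[folded has_real_derivative_iff_has_vector_derivative]]
    have "(\<psi> has_real_derivative (snd (p 0) \<bullet> fst \<Delta>) * (h s / L)
        + (snd \<Delta> \<bullet> fst \<Delta>) / 2 * (2 * (arc s / L) * (h s / L))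
        + ((fst (p s) - fst (shadow s)) \<bullet> (snd (fst (vel s)) + snd ((h s / L) *\<^sub>R \<Delta>))
           + (fst (fst (vel s)) - fst ((h s / L) *\<^sub>R \<Delta>)) \<bullet> (snd (p s) + snd (shadow s))) / 2) (at s)"
      unfolding \<psi>_def[abs_def] .
    moreover have "(snd (p 0) \<bullet> fst \<Delta>) * (h s / L)
        + (snd \<Delta> \<bullet> fst \<Delta>) / 2 * (2 * (arc s / L) * (h s / L))
        + ((fst (p s) - fst (shadow s)) \<bullet> (snd (fst (vel s)) + snd ((h s / L) *\<^sub>R \<Delta>))
           + (fst (fst (vel s)) - fst ((h s / L) *\<^sub>R \<Delta>)) \<bullet> (snd (p s) + snd (shadow s))) / 2
        = ydx s - g s"
    proof -
      define t where "t = arc s / L"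
      define k where "k = h s / L"
      show ?thesis
        unfolding ydx_def g_def v_def sh t_def[symmetric] k_def[symmetric]
        by (simp add: inner_diff_left inner_diff_right inner_add_left inner_add_right
            inner_commute field_simps)
    qed
    ultimately show ?thesis by (simp add: has_real_derivative_iff_has_vector_derivative)
  qed
  have "continuous_on {0..l} \<psi>"
    unfolding \<psi>_def sh by (intro continuous_intros arc_continuous p_cont) (use L in auto)
  then have "((\<lambda>s. ydx s - g s) has_integral \<psi> l - \<psi> 0) {0..l}"
    using der by (intro fundamental_theorem_of_calculus_interior_strong[OF fin nonneg]) auto
  moreover have "(ydx has_integral integral {0..l} ydx) {0..l}"
    using integrable(3)[of 0 l] by (simp add: has_integral_integral)
  \<comment> \<open>Integrability of \<open>g\<close> comes from subtracting the derivative of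
    \<open>\<psi>\<close> from \<open>ydx\<close>.\<close>
  ultimately have g: "(g has_integral integral {0..l} ydx - (\<psi> l - \<psi> 0)) {0..l}"
    using has_integral_diff[of ydx "integral {0..l} ydx" "{0..l}" "\<lambda>s. ydx s - g s"] by simp
  have "\<psi> l - \<psi> 0 = (snd (p 0) + snd (p l)) \<bullet> (fst (p l) - fst (p 0)) / 2"
    using False L unfolding \<psi>_def
    by (simp add: shadow_ends L_def \<Delta>_def inner_add_left inner_diff_left field_simps)
  moreover have "norm (integral {0..l} g) \<le> integral {0..l} (\<lambda>s. W * (1 + chord / L) / 2 * h s)"
  proof (rule integral_norm_bound_integral)
    show "g integrable_on {0..l}" using g by auto
    show "(\<lambda>s. W * (1 + chord / L) / 2 * h s) integrable_on {0..l}"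
      using integrable(1)[of 0 l] by (intro integrable_on_mult_right) simp
    fix s assume s: "s \<in> {0..l}"
    have W: "norm (p s - shadow s) \<le> W"
      using shadow_dist[of s] s by (simp add: W_def L_def)
    have "norm (v s) \<le> norm ((h s / L) *\<^sub>R \<Delta>) + h s"
      unfolding v_def h_def by (rule norm_triangle_ineq)
    also have "\<dots> = h s * (1 + chord / L)"
      using L h_nonneg[of s] by (simp add: chord_def[folded \<Delta>_def] ring_distribs)
    finally have "norm (p s - shadow s) * norm (v s) \<le> W * (h s * (1 + chord / L))"
      using W order_trans[OF norm_ge_zero W] by (intro mult_mono) auto
    then show "norm (g s) \<le> W * (1 + chord / L) / 2 * h s"
      using symplectic_le_norm[of "p s - shadow s" "v s"] by (simp add: g_def mult_ac)
  qed
  moreover have "integral {0..l} (\<lambda>s. W * (1 + chord / L) / 2 * h s) = W * (1 + chord / L) / 2 * L"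
    by (simp add: L_def arc_def)
  moreover have "W * (1 + chord / L) / 2 * L = W * (L + chord) / 2"
    using L by (simp add: field_simps)
  ultimately show ?thesis
    using integral_unique[OF g] by (simp only: W_def L_def real_norm_def)
qed

end

section \<open>Midpoints of minimizers\<close>

text \<open>The parallelogram law.\<close>

lemma norm_midpoint_power2:
  fixes P Q :: "'a::real_inner"
  shows "(norm (P + (1 / 2) *\<^sub>R (Q - P)))\<^sup>2 = ((norm P)\<^sup>2 + (norm Q)\<^sup>2) / 2 - (norm (Q - P))\<^sup>2 / 4"
  unfolding power2_norm_eq_inner
  by (simp add: inner_diff_left inner_diff_right inner_add_left inner_add_right inner_commute field_simps)

context heis_curve
begin

lemma unit_speed_components:
  assumes "unit_speed l \<gamma>" "s \<in> {0..l} - T"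
  shows "(h s)\<^sup>2 + (eta s)\<^sup>2 = 1"
proof -
  have "s \<in> {0<..<l}" using assms(2) zero_in end_in by (auto simp: order.order_iff_strict)
  moreover have "\<gamma> differentiable (at s)" using has_vel[OF assms(2)] by (rule differentiableI_vector)
  ultimately have "heis_norm (\<gamma> s) (vel s) = 1"
    using assms(1) by (simp add: unit_speed_def vel_def)
  then show ?thesis by (simp add: heis_norm_eq h_def eta_def)
qed

lemma unit_speed_length:
  assumes "unit_speed l \<gamma>"
  shows "heis_length l \<gamma> = l"
proof -
  have "heis_length l \<gamma> = integral {0..l} (\<lambda>s. 1)"
    unfolding heis_length_def vel_def[symmetric]
    using unit_speed_components[OF assms]
    by (intro integral_eq_off_finite[OF fin]) (simp add: heis_norm_eq h_def eta_def)
  then show ?thesis using nonneg by simp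
qed

text \<open>Off the break points \<open>(h, eta)\<close> is a unit vector of the plane, so its
  integral has norm at most \<open>b - a\<close>. This is proved by pairing the vector with its own
  integral.\<close>

lemma unit_speed_displacement_le:
  assumes "unit_speed l \<gamma>" and ab: "0 \<le> a" "a \<le> b" "b \<le> l"
  shows "(integral {a..b} h)\<^sup>2 + (integral {a..b} eta)\<^sup>2 \<le> (b - a)\<^sup>2"
proof -
  let ?H = "integral {a..b} h" and ?E = "integral {a..b} eta"
  define r where "r = sqrt (?H\<^sup>2 + ?E\<^sup>2)"
  have r: "0 \<le> r" "r\<^sup>2 = ?H\<^sup>2 + ?E\<^sup>2" by (simp_all add: r_def)
  note int = integrable[OF ab(1,3)]
  have "norm (integral {a..b} (\<lambda>s. ?H * h s + ?E * eta s)) \<le> integral {a..b} (\<lambda>s. r)"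
  proof (rule norm_integral_le_off_finite[OF fin])
    show "(\<lambda>s. ?H * h s + ?E * eta s) integrable_on {a..b}"
      using int by (intro integrable_add integrable_on_mult_right)
    fix s assume "s \<in> {a..b} - T"
    then have 1: "(h s)\<^sup>2 + (eta s)\<^sup>2 = 1"
      using ab by (intro unit_speed_components assms) auto
    have "(?H * h s + ?E * eta s)\<^sup>2 = (?H\<^sup>2 + ?E\<^sup>2) * ((h s)\<^sup>2 + (eta s)\<^sup>2) - (?H * eta s - ?E * h s)\<^sup>2"
      by algebra
    also have "\<dots> \<le> r\<^sup>2" unfolding 1 r(2) by simp
    finally show "norm (?H * h s + ?E * eta s) \<le> r"
      using r(1) by (simp add: power2_le_iff_abs_le)
  qed (simp add: integrable_const_ivl)
  moreover have "integral {a..b} (\<lambda>s. ?H * h s + ?E * eta s) = r\<^sup>2"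
    using int by (subst integral_add) (simp_all add: integrable_on_mult_right r(2) flip: power2_eq_square)
  ultimately have "r * r \<le> (b - a) * r" using ab by (simp add: power2_eq_square)
  then have "r \<le> b - a" using ab r(1) by (cases "r = 0") (auto simp: mult_le_cancel_right)
  then show ?thesis using r power_mono[of r "b - a" 2] by simp
qed

end

locale minimizing_heis_curve = heis_curve +
  assumes minimizing: "minimizing_magnetic_geodesic l \<gamma>"
begin

lemma unit: "unit_speed l \<gamma>"
  using minimizing by (simp add: minimizing_magnetic_geodesic_def)

lemma action_le:
  assumes "piecewise_C1_curve l' \<sigma>" "\<sigma> 0 = \<gamma> 0" "\<sigma> l' = \<gamma> l"
  shows "l - integral {0..l} eta \<le> heis_length l' \<sigma> - eta_integral l' \<sigma>"
proof -
  have "eta_integral l \<gamma> = integral {0..l} eta"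
    by (simp add: eta_integral_def eta_def[abs_def] vel_def)
  then show ?thesis
    using minimizing assms unit_speed_length[OF unit]
    unfolding minimizing_magnetic_geodesic_def by metis
qed

text \<open>The integral of the contact form over a lift of the straight chord that joins the two
  end points: the \<open>k\<close> of \<open>straight_competitor\<close> and the \<open>E0\<close>
  of \<open>bulge_bounds\<close>.\<close>

definition chord_height :: real where
  "chord_height = snd (\<gamma> l) - snd (\<gamma> 0) - (snd (p 0) + snd (p l)) \<bullet> (fst (p l) - fst (p 0)) / 2"

lemma action_le_straight:
  "l - integral {0..l} eta \<le> sqrt (chord\<^sup>2 + chord_height\<^sup>2) - chord_height"
proof -
  obtain \<sigma> where "piecewise_C1_curve 1 \<sigma>" "\<sigma> 0 = (p 0, snd (\<gamma> 0))" "\<sigma> 1 = (p l, snd (\<gamma> l))"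
    "heis_length 1 \<sigma> - eta_integral 1 \<sigma> = sqrt (chord\<^sup>2 + chord_height\<^sup>2) - chord_height"
    using straight_competitor[where P = "p 0" and Q = "p l" and ?z0.0 = "snd (\<gamma> 0)" and ?z1.0 = "snd (\<gamma> l)"]
    unfolding chord_def chord_height_def by metis
  then show ?thesis
    using action_le[of 1 \<sigma>] by (simp add: p_def)
qed

text \<open>The proportional competitor with slope \<open>E / L\<close> ends at the same point and
  has action \<open>sqrt (L\<^sup>2 + E\<^sup>2) - E\<close>. Together with
  \<open>unit_speed_displacement_le\<close> this forces equality.\<close>

lemma length_le:
  assumes "0 \<le> chord_height"
  shows "l\<^sup>2 \<le> (arc l)\<^sup>2 + (integral {0..l} eta)\<^sup>2"
proof (cases "arc l = 0")
  \<comment> \<open>The slope is undefined here, but the straight competitor has action 0 since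
    \<open>chord_height\<close> is nonnegative.\<close>
  case True
  then have "chord = 0" using chord_le by simp
  then have "l \<le> integral {0..l} eta" using action_le_straight assms by simp
  then show ?thesis using nonneg power_mono[of l _ 2] True by simp
next
  case False
  define E where "E = integral {0..l} eta"
  define L where "L = arc l"
  have L: "0 < L" using False arc_mono(1)[of l] by (simp add: L_def)
  obtain \<sigma> where \<sigma>: "piecewise_C1_curve l \<sigma>" "\<sigma> 0 = \<gamma> 0"
    "\<sigma> l = (p l, snd (\<gamma> 0) + integral {0..l} ydx + E / L * arc l)"
    "heis_length l \<sigma> - eta_integral l \<sigma> = (sqrt (1 + (E / L)\<^sup>2) - E / L) * arc l"
    by (rule proportional_competitor)
  have "\<sigma> l = \<gamma> l"
    using height_eq[of 0 l] nonneg L by (simp add: \<sigma>(3) E_def L_def p_def prod_eq_iff)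
  then have "l - E \<le> (sqrt (1 + (E / L)\<^sup>2) - E / L) * L"
    using action_le[OF \<sigma>(1,2)] \<sigma>(4) by (simp add: E_def L_def)
  also have "\<dots> = sqrt (1 + (E / L)\<^sup>2) * L - E"
    using L by (simp add: algebra_simps)
  finally have "l \<le> sqrt (1 + (E / L)\<^sup>2) * L" by simp
  then have "l\<^sup>2 \<le> (sqrt (1 + (E / L)\<^sup>2) * L)\<^sup>2" using nonneg by (rule power_mono)
  also have "\<dots> = L\<^sup>2 + E\<^sup>2"
    using L by (simp add: power_mult_distrib field_simps)
  finally show ?thesis by (simp add: E_def L_def)
qed

text \<open>Equality in the triangle inequality for the displacements over the two halves.\<close>

lemma arc_half:
  assumes "0 \<le> chord_height"
  shows "arc (l / 2) = arc l / 2" "integral {0..l/2} eta = integral {l/2..l} eta"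
proof -
  let ?m = "l / 2"
  have m: "0 \<le> ?m" "?m \<le> l" using nonneg by auto
  define L1 where "L1 = integral {0..?m} h"
  define L2 where "L2 = integral {?m..l} h"
  define E1 where "E1 = integral {0..?m} eta"
  define E2 where "E2 = integral {?m..l} eta"
  have "L1\<^sup>2 + E1\<^sup>2 \<le> ?m\<^sup>2" "L2\<^sup>2 + E2\<^sup>2 \<le> (l - ?m)\<^sup>2"
    using unit_speed_displacement_le[OF unit, of 0 ?m] unit_speed_displacement_le[OF unit, of ?m l] m
    by (simp_all add: L1_def L2_def E1_def E2_def)
  moreover have "arc l = L1 + L2"
    using Henstock_Kurzweil_Integration.integral_combine[OF m integrable(1)[of 0 l]]
    by (simp add: L1_def L2_def arc_def)
  moreover have "integral {0..l} eta = E1 + E2"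
    using Henstock_Kurzweil_Integration.integral_combine[OF m integrable(2)[of 0 l]]
    by (simp add: E1_def E2_def)
  \<comment> \<open>The left side is twice the sum of the squared half displacements, at most
    \<open>l\<^sup>2\<close>, minus the squared total displacement, at least
    \<open>l\<^sup>2\<close>.\<close>
  ultimately have "(L1 - L2)\<^sup>2 + (E1 - E2)\<^sup>2 \<le> 0"
    using length_le[OF assms] by (simp add: power2_eq_square algebra_simps)
  then have "L1 = L2 \<and> E1 = E2" by (simp add: sum_power2_le_zero_iff)
  then show "arc ?m = arc l / 2" "integral {0..?m} eta = integral {?m..l} eta"
    using \<open>arc l = L1 + L2\<close> by (simp_all add: L1_def arc_def E1_def E2_def)
qed

section \<open>Minimizers with both end points over a small ball\<close>

context
  fixes \<rho> :: real
  assumes \<rho>: "0 < \<rho>" "\<rho> \<le> 1" and ends: "norm (p 0) \<le> \<rho>" "norm (p l) \<le> \<rho>"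
    and height: "3 * \<rho>\<^sup>2 \<le> snd (\<gamma> l) - snd (\<gamma> 0)"
begin

lemma chord_le_diameter: "chord \<le> 2 * \<rho>"
  using norm_triangle_ineq4[of "p l" "p 0"] ends by (simp add: chord_def)

text \<open>Both factors of the trapezoidal term are at most \<open>2 * \<rho>\<close>. With a
  height gap of \<open>3 * \<rho>\<^sup>2\<close> this leaves the \<open>\<rho>\<^sup>2\<close> that
  \<open>bulge_bounds\<close> asks of \<open>E0\<close>.\<close>

lemma chord_height_ge: "snd (\<gamma> l) - snd (\<gamma> 0) - 2 * \<rho>\<^sup>2 \<le> chord_height"
proof -
  have "\<bar>(snd (p 0) + snd (p l)) \<bullet> (fst (p l) - fst (p 0))\<bar>
      \<le> norm (snd (p 0 + p l)) * norm (fst (p l - p 0))"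
    using Cauchy_Schwarz_ineq2 by simp
  also have "\<dots> \<le> (2 * \<rho>) * (2 * \<rho>)"
  proof (intro mult_mono)
    show "norm (snd (p 0 + p l)) \<le> 2 * \<rho>"
      using norm_snd_le[of "snd (p 0 + p l)" "fst (p 0 + p l)"] norm_triangle_ineq[of "p 0" "p l"] ends
      by (simp only: prod.collapse)
    show "norm (fst (p l - p 0)) \<le> 2 * \<rho>"
      using norm_fst_le[of "fst (p l - p 0)" "snd (p l - p 0)"] chord_le_diameter
      unfolding chord_def by (simp only: prod.collapse)
  qed (use \<rho> in auto)
  finally show ?thesis by (simp add: chord_height_def power2_eq_square abs_le_iff)
qed

lemma chord_height_nonneg: "0 \<le> chord_height"
  using chord_height_ge height zero_le_power2[of \<rho>] by linarith

text \<open>The quantities \<open>c\<close> and \<open>W\<close> of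
  \<open>bulge_bounds\<close>.\<close>

abbreviation (input) action where "action \<equiv> sqrt (chord\<^sup>2 + chord_height\<^sup>2) - chord_height"
abbreviation (input) bulge where "bulge \<equiv> sqrt ((arc l)\<^sup>2 - chord\<^sup>2) / 2"

lemma bulge_estimates:
  "0 \<le> action" "2 * action * chord_height \<le> chord\<^sup>2" "action \<le> 5 / 4"
  "bulge \<le> action * chord" "arc l \<le> 3 * chord"
proof -
  have E0: "\<rho>\<^sup>2 \<le> chord_height" using chord_height_ge height by linarith
  have len: "(arc l)\<^sup>2 + (integral {0..l} eta)\<^sup>2 \<le> l\<^sup>2"
    using unit_speed_displacement_le[OF unit, of 0 l] nonneg by (simp add: arc_def)
  \<comment> \<open>The height difference cancels, leaving only the area between curve and
    chord.\<close>
  have "integral {0..l} eta - chord_height =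
      - (integral {0..l} ydx - (snd (p 0) + snd (p l)) \<bullet> (fst (p l) - fst (p 0)) / 2)"
    using height_eq[of 0 l] nonneg by (simp add: chord_height_def)
  also have "\<dots> \<le> bulge * (arc l + chord) / 2"
    using area_between_curve_and_chord by linarith
  finally have area: "integral {0..l} eta - chord_height \<le> bulge * (arc l + chord) / 2" .
  have l: "l \<le> action + integral {0..l} eta" using action_le_straight by simp
  note b = bulge_bounds[OF chord_le(2,1) chord_le_diameter \<rho> E0 refl nonneg l len refl area]
  show "0 \<le> action" "2 * action * chord_height \<le> chord\<^sup>2" "action \<le> 5 / 4"
    "bulge \<le> action * chord" "arc l \<le> 3 * chord"
    by (fact b)+
qed

lemma bulge_le: "bulge \<le> 5 / 2 * \<rho>"
proof -
  have "action * chord \<le> 5 / 4 * (2 * \<rho>)"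
    by (intro mult_mono bulge_estimates chord_le chord_le_diameter) simp
  then show ?thesis using bulge_estimates(4) by linarith
qed

text \<open>The shadow stays in the ball by convexity, and the bulge adds at most
  \<open>5 / 2 * \<rho>\<close>.\<close>

lemma curve_bounded:
  assumes "0 \<le> s" "s \<le> l"
  shows "norm (p s) \<le> 4 * \<rho>"
proof -
  define t where "t = arc s / arc l"
  have t: "0 \<le> t" "t \<le> 1"
    using arc_mono[of s] arc_mono(1)[of l] assms by (auto simp: t_def divide_le_eq_1)
  have "shadow s = (1 - t) *\<^sub>R p 0 + t *\<^sub>R p l"
    by (simp add: shadow_def t_def algebra_simps)
  also have "norm \<dots> \<le> (1 - t) * norm (p 0) + t * norm (p l)"
    using t norm_triangle_ineq[of "(1 - t) *\<^sub>R p 0" "t *\<^sub>R p l"] by simp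
  also have "\<dots> \<le> (1 - t) * \<rho> + t * \<rho>"
    using t ends by (intro add_mono mult_left_mono) auto
  finally have "norm (shadow s) \<le> \<rho>" by (simp add: algebra_simps)
  moreover have "norm (p s) \<le> norm (shadow s) + norm (p s - shadow s)"
    by (metis add.commute diff_add_cancel norm_triangle_ineq)
  ultimately show ?thesis
    using shadow_dist[OF assms] bulge_le \<rho> by linarith
qed

text \<open>The midpoint of a chord of length \<open>d\<close> lies within \<open>\<rho> - d\<^sup>2 / (8 * \<rho>)\<close> of the centre;
  for tall pairs this gain absorbs the bulge.\<close>

lemma midpoint_in_ball:
  assumes "10 * \<rho>\<^sup>2 \<le> snd (\<gamma> l) - snd (\<gamma> 0)"
  shows "norm (p (l / 2)) \<le> \<rho>"
proof -
  have E0: "8 * \<rho>\<^sup>2 \<le> chord_height" using chord_height_ge assms by linarith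
  define c where "c = action"
  define d where "d = chord"
  have d: "0 \<le> d" "d \<le> 2 * \<rho>" using chord_le chord_le_diameter by (simp_all add: d_def)
  have c: "0 \<le> c" "2 * c * chord_height \<le> d\<^sup>2" "bulge \<le> c * d"
    using bulge_estimates by (simp_all only: c_def d_def)
  \<comment> \<open>A \<open>chord_height\<close> of \<open>8 * \<rho>\<^sup>2\<close> gives
    \<open>c \<le> d\<^sup>2 / (16 * \<rho>\<^sup>2)\<close>; one factor
    \<open>d \<le> 2 * \<rho>\<close> then turns \<open>c * d\<close> into at most
    \<open>d\<^sup>2 / (8 * \<rho>)\<close>, the gain at the midpoint.\<close>
  have "2 * c * (8 * \<rho>\<^sup>2) \<le> 2 * c * chord_height" using c E0 by (intro mult_left_mono) auto
  then have "c * (16 * \<rho>\<^sup>2) \<le> d\<^sup>2" using c(2) by linarith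
  then have "c * (16 * \<rho>\<^sup>2) * d \<le> d\<^sup>2 * (2 * \<rho>)" using d by (intro mult_mono) auto
  then have "(8 * \<rho> * (c * d)) * (2 * \<rho>) \<le> d\<^sup>2 * (2 * \<rho>)" by (simp add: power2_eq_square mult_ac)
  then have "8 * \<rho> * (c * d) \<le> d\<^sup>2" using \<rho> by (simp only: mult_le_cancel_right_pos)
  then have cd: "c * d \<le> d\<^sup>2 / (8 * \<rho>)" using \<rho> by (simp add: field_simps)
  define q where "q = p 0 + (1 / 2) *\<^sub>R (p l - p 0)"
  have "shadow (l / 2) = q"
  proof (cases "arc l = 0")
    case True
    then have "p l = p 0" using chord_le by (simp add: chord_def)
    then show ?thesis by (simp add: shadow_def q_def)
  next
    case False
    then show ?thesis by (simp add: shadow_def q_def arc_half[OF chord_height_nonneg])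
  qed
  then have 1: "norm (p (l / 2) - q) \<le> c * d"
    using shadow_dist[of "l / 2"] nonneg c(3) by simp
  have "(norm q)\<^sup>2 = ((norm (p 0))\<^sup>2 + (norm (p l))\<^sup>2) / 2 - d\<^sup>2 / 4"
    unfolding q_def norm_midpoint_power2 d_def chord_def ..
  also have "\<dots> \<le> (\<rho>\<^sup>2 + \<rho>\<^sup>2) / 2 - d\<^sup>2 / 4"
    using ends by (intro diff_right_mono divide_right_mono add_mono power_mono) auto
  \<comment> \<open>Completes the square.\<close>
  also have "\<dots> \<le> \<rho>\<^sup>2 - d\<^sup>2 / 4 + (d\<^sup>2 / (8 * \<rho>))\<^sup>2" by simp
  also have "\<dots> = (\<rho> - d\<^sup>2 / (8 * \<rho>))\<^sup>2"
    using \<rho> by (simp add: power2_diff)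
  finally have "norm q \<le> \<rho> - d\<^sup>2 / (8 * \<rho>)"
  proof (rule power2_le_imp_le)
    have "d\<^sup>2 \<le> (2 * \<rho>)\<^sup>2" using d by (intro power_mono) auto
    then have "d\<^sup>2 \<le> 4 * \<rho>\<^sup>2" by (simp add: power_mult_distrib)
    also have "\<dots> \<le> 8 * \<rho>\<^sup>2" by simp
    finally have "d\<^sup>2 \<le> 8 * \<rho>\<^sup>2" .
    then show "0 \<le> \<rho> - d\<^sup>2 / (8 * \<rho>)"
      using \<rho> by (simp add: pos_divide_le_eq power2_eq_square)
  qed
  moreover have "norm (p (l / 2)) \<le> norm q + norm (p (l / 2) - q)"
    by (metis add.commute diff_add_cancel norm_triangle_ineq)
  ultimately show ?thesis using 1 cd by linarith
qed

text \<open>Equal integrals of the contact form over the halves cancel, leaving half the difference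
  of the \<open>y dx\<close> integrals. With radius \<open>4 * \<rho>\<close> and
  \<open>arc l \<le> 6 * \<rho>\<close> this is at most \<open>12 * \<rho>\<^sup>2\<close>.\<close>

lemma midpoint_height:
  "\<bar>snd (\<gamma> (l / 2)) - (snd (\<gamma> 0) + snd (\<gamma> l)) / 2\<bar> \<le> 12 * \<rho>\<^sup>2"
proof -
  let ?m = "l / 2"
  have m: "0 \<le> ?m" "?m \<le> l" using nonneg by auto
  have "snd (\<gamma> ?m) - (snd (\<gamma> 0) + snd (\<gamma> l)) / 2 = (integral {0..?m} ydx - integral {?m..l} ydx) / 2"
    using height_eq[of 0 ?m] height_eq[of ?m l] m arc_half(2)[OF chord_height_nonneg]
    by (simp add: field_simps)
  moreover have "\<bar>integral {0..?m} ydx\<bar> \<le> 4 * \<rho> * integral {0..?m} h"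
    using m by (intro ydx_bound curve_bounded) auto
  moreover have "\<bar>integral {?m..l} ydx\<bar> \<le> 4 * \<rho> * integral {?m..l} h"
    using m by (intro ydx_bound curve_bounded) auto
  moreover have "4 * \<rho> * integral {0..?m} h + 4 * \<rho> * integral {?m..l} h = 4 * \<rho> * arc l"
    using arc_split[OF m] unfolding distrib_left[symmetric] by (simp add: arc_def)
  moreover have "4 * \<rho> * arc l \<le> 4 * \<rho> * (6 * \<rho>)"
    using bulge_estimates(5) chord_le_diameter \<rho> by (intro mult_left_mono) linarith+
  moreover have "4 * \<rho> * (6 * \<rho>) = 24 * \<rho>\<^sup>2" by (simp add: power2_eq_square)
  ultimately show ?thesis unfolding abs_le_iff diff_divide_distrib by linarith
qed

end

end

section \<open>Covering the average by two cylinders, and the volume estimate\<close>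

text \<open>Pairs with height gap at least \<open>10 * \<rho>\<^sup>2\<close> have their midpoint
  over the ball itself and fill the first cylinder; the others fall into the short wide one.\<close>

lemma average_subset:
  fixes B :: "((real ^ 'm::finite) \<times> (real ^ 'm)) set"
  assumes \<rho>: "0 < \<rho>" "\<rho> \<le> 1" and t: "b + 3 * \<rho>\<^sup>2 \<le> t" and B: "B \<subseteq> cball 0 \<rho>"
  shows "magnetic_average (1/2) (B \<times> {0..b}) (B \<times> {t..t + b}) \<subseteq>
    cball 0 \<rho> \<times> {t / 2 - 12 * \<rho>\<^sup>2..t / 2 + b + 12 * \<rho>\<^sup>2} \<union>
    cball 0 (4 * \<rho>) \<times> {(t + b) / 2 - 17 * \<rho>\<^sup>2..(t + b) / 2 + 17 * \<rho>\<^sup>2}"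
proof
  fix w assume "w \<in> magnetic_average (1/2) (B \<times> {0..b}) (B \<times> {t..t + b})"
  then obtain \<gamma> l where w: "w = \<gamma> (l / 2)" and min: "minimizing_magnetic_geodesic l \<gamma>"
    and ends: "\<gamma> 0 \<in> B \<times> {0..b}" "\<gamma> l \<in> B \<times> {t..t + b}"
    by (auto simp: magnetic_average_def)
  obtain T where "C1_pieces l \<gamma> T"
    using min piecewise_C1_curve_iff unfolding minimizing_magnetic_geodesic_def by blast
  then interpret C1_pieces l \<gamma> T .
  interpret minimizing_heis_curve l \<gamma> T by unfold_locales (rule min)
  have z: "0 \<le> snd (\<gamma> 0)" "snd (\<gamma> 0) \<le> b" "t \<le> snd (\<gamma> l)" "snd (\<gamma> l) \<le> t + b"
    using ends by (auto simp: mem_Times_iff)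
  have "norm (p 0) \<le> \<rho>" "norm (p l) \<le> \<rho>"
    using ends B by (auto simp: mem_Times_iff p_def)
  moreover have "3 * \<rho>\<^sup>2 \<le> snd (\<gamma> l) - snd (\<gamma> 0)" using z t by linarith
  ultimately have hyp: "norm (p 0) \<le> \<rho>" "norm (p l) \<le> \<rho>" "3 * \<rho>\<^sup>2 \<le> snd (\<gamma> l) - snd (\<gamma> 0)" by auto
  have mid: "\<bar>snd w - (snd (\<gamma> 0) + snd (\<gamma> l)) / 2\<bar> \<le> 12 * \<rho>\<^sup>2"
    unfolding w by (rule midpoint_height[OF \<rho> hyp])
  have fst: "fst w = p (l / 2)" by (simp add: w p_def)
  show "w \<in> cball 0 \<rho> \<times> {t / 2 - 12 * \<rho>\<^sup>2..t / 2 + b + 12 * \<rho>\<^sup>2} \<union>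
    cball 0 (4 * \<rho>) \<times> {(t + b) / 2 - 17 * \<rho>\<^sup>2..(t + b) / 2 + 17 * \<rho>\<^sup>2}"
  proof (cases "10 * \<rho>\<^sup>2 \<le> snd (\<gamma> l) - snd (\<gamma> 0)")
    case True
    then have "norm (fst w) \<le> \<rho>" unfolding fst by (rule midpoint_in_ball[OF \<rho> hyp])
    moreover have "t / 2 - 12 * \<rho>\<^sup>2 \<le> snd w" "snd w \<le> t / 2 + b + 12 * \<rho>\<^sup>2"
      using mid z unfolding abs_le_iff add_divide_distrib by linarith+
    ultimately show ?thesis by (simp add: mem_Times_iff)
  next
    case False
    have "norm (fst w) \<le> 4 * \<rho>" unfolding fst using curve_bounded[OF \<rho> hyp] nonneg by simp
    \<comment> \<open>With a gap below \<open>10 * \<rho>\<^sup>2\<close>, one end below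
      \<open>b\<close> and the other above \<open>t\<close>, the average height is within
      \<open>5 * \<rho>\<^sup>2\<close> of \<open>(t + b) / 2\<close>;
      \<open>midpoint_height\<close> adds 12.\<close>
    moreover have "(t + b) / 2 - 17 * \<rho>\<^sup>2 \<le> snd w" "snd w \<le> (t + b) / 2 + 17 * \<rho>\<^sup>2"
      using mid z False t zero_le_power2[of \<rho>] unfolding abs_le_iff add_divide_distrib by linarith+
    ultimately show ?thesis by (simp add: mem_Times_iff)
  qed
qed

lemma outer_measure_of_Un_le:
  assumes "A \<in> sets M" "B \<in> sets M" "S \<subseteq> A \<union> B"
  shows "outer_measure_of M S \<le> outer_measure_of M A + outer_measure_of M B"
proof -
  have "outer_measure_of M S \<le> outer_measure_of M (A \<union> B)"
    by (rule outer_measure_of_mono[OF assms(3)])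
  also have "\<dots> = emeasure M (A \<union> B)"
    using assms by (intro outer_measure_of_eq) auto
  also have "\<dots> \<le> emeasure M A + emeasure M B"
    by (rule emeasure_subadditive) fact+
  finally show ?thesis using assms by (simp only: outer_measure_of_eq)
qed

lemma root_one_plus_le:
  assumes "0 < n" "0 \<le> x"
  shows "root n (1 + x) \<le> 1 + x"
proof -
  have "root n (1 + x) \<le> root n ((1 + x) ^ n)"
    using assms by (simp add: self_le_power)
  then show ?thesis using assms by (simp add: real_root_power_cancel)
qed

text \<open>Both the open and the closed ball are covered. Since \<open>enn2real\<close> maps
  infinity to 0, finiteness of the volume is asserted along with the inequality.\<close>

theorem lemma6p7:
  "\<exists>C::real. \<forall>(\<rho>::real) (t::real) (b::real).
     0 < \<rho> \<and> \<rho> \<le> 1 \<and> 0 < t \<and> 0 < b \<and> t \<ge> b + 3 * \<rho>\<^sup>2 \<longrightarrow>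
     (\<forall>B :: ((real ^ 'm::finite) \<times> (real ^ 'm)) set. B = ball 0 \<rho> \<or> B = cball 0 \<rho> \<longrightarrow>
        (let n = 2 * CARD('m) + 1;
             A0 = B \<times> {0..b};
             A1 = B \<times> {t..t + b};
             A = magnetic_average (1/2) A0 A1
         in Vol A < \<infinity> \<and>
            root n (enn2real (Vol A))
              \<le> (1 + C * (\<rho>\<^sup>2 / b)) *
                 ((root n (enn2real (Vol A0)) + root n (enn2real (Vol A1))) / 2)))"
proof (intro exI allI impI)
  fix \<rho> t b :: real and B :: "((real ^ 'm) \<times> (real ^ 'm)) set"
  assume asm: "0 < \<rho> \<and> \<rho> \<le> 1 \<and> 0 < t \<and> 0 < b \<and> t \<ge> b + 3 * \<rho>\<^sup>2"
    and B: "B = ball 0 \<rho> \<or> B = cball 0 \<rho>"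
  then have \<rho>: "0 < \<rho>" "\<rho> \<le> 1" and t: "b + 3 * \<rho>\<^sup>2 \<le> t" and b: "0 < b" by auto
  define k where "k = 2 * CARD('m)"
  define n where "n = k + 1"
  \<comment> \<open>24 is the extra height of \<open>S1\<close>; 34 is the height of
    \<open>S2\<close>, both in units of \<open>\<rho>\<^sup>2\<close>, and \<open>4 ^ k\<close>
    comes from the radius \<open>4 * \<rho>\<close> in dimension \<open>k\<close>.\<close>
  define C :: real where "C = 24 + 34 * 4 ^ k"
  define u where "u = unit_ball_vol k * \<rho> ^ k"
  define A where "A = magnetic_average (1/2) (B \<times> {0..b}) (B \<times> {t..t + b})"
  define S1 where "S1 = cball (0 :: (real ^ 'm) \<times> (real ^ 'm)) \<rho> \<times> {t / 2 - 12 * \<rho>\<^sup>2..t / 2 + b + 12 * \<rho>\<^sup>2}"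
  define S2 where "S2 = cball (0 :: (real ^ 'm) \<times> (real ^ 'm)) (4 * \<rho>) \<times>
    {(t + b) / 2 - 17 * \<rho>\<^sup>2..(t + b) / 2 + 17 * \<rho>\<^sup>2}"
  have u: "0 \<le> u" using \<rho> by (simp add: u_def)
  have C: "0 \<le> C" by (simp add: C_def)
  have V0: "Vol (B \<times> {0..b}) = ennreal (u * b)"
    using Vol_ball_Times[OF B, of 0 b] \<rho> b by (simp add: u_def k_def)
  have V1: "Vol (B \<times> {t..t + b}) = ennreal (u * b)"
    using Vol_ball_Times[OF B, of t "t + b"] \<rho> b by (simp add: u_def k_def)
  have W1: "Vol S1 = ennreal (u * (b + 24 * \<rho>\<^sup>2))"
  proof -
    have "t / 2 - 12 * \<rho>\<^sup>2 \<le> t / 2 + b + 12 * \<rho>\<^sup>2"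
      using b zero_le_power2[of \<rho>] by linarith
    from Vol_ball_Times[OF disjI2[OF refl] less_imp_le[OF \<rho>(1)] this] show ?thesis
      by (simp add: S1_def u_def k_def algebra_simps)
  qed
  have W2: "Vol S2 = ennreal (u * (34 * 4 ^ k * \<rho>\<^sup>2))"
  proof -
    have "(t + b) / 2 - 17 * \<rho>\<^sup>2 \<le> (t + b) / 2 + 17 * \<rho>\<^sup>2"
      using zero_le_power2[of \<rho>] by linarith
    from Vol_ball_Times[OF disjI2[OF refl] _ this, of "4 * \<rho>"] show ?thesis
      using \<rho> by (simp add: S2_def u_def k_def power_mult_distrib mult_ac)
  qed
  have sets: "S1 \<in> sets heis_volume" "S2 \<in> sets heis_volume"
    unfolding S1_def S2_def heis_volume_eq_lborel sets_lborel by (intro borel_closed closed_Times closed_cball closed_atLeastAtMost)+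
  have "A \<subseteq> S1 \<union> S2"
    unfolding A_def S1_def S2_def by (rule average_subset[OF \<rho> t]) (use B in auto)
  from outer_measure_of_Un_le[OF sets this]
  have "Vol A \<le> Vol S1 + Vol S2" by (simp only: Vol_def)
  also have "\<dots> = ennreal (u * (b + 24 * \<rho>\<^sup>2) + u * (34 * 4 ^ k * \<rho>\<^sup>2))"
    unfolding W1 W2 using u b by (intro ennreal_plus[symmetric] mult_nonneg_nonneg add_nonneg_nonneg) auto
  also have "u * (b + 24 * \<rho>\<^sup>2) + u * (34 * 4 ^ k * \<rho>\<^sup>2) = (1 + C * (\<rho>\<^sup>2 / b)) * (u * b)"
    using b by (simp add: C_def field_simps)
  finally have VA: "Vol A \<le> ennreal ((1 + C * (\<rho>\<^sup>2 / b)) * (u * b))" .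
  have x: "0 \<le> C * (\<rho>\<^sup>2 / b)" using C b by simp
  have "enn2real (Vol A) \<le> (1 + C * (\<rho>\<^sup>2 / b)) * (u * b)"
    using VA x u b by (intro enn2real_leI) auto
  then have "root n (enn2real (Vol A)) \<le> root n ((1 + C * (\<rho>\<^sup>2 / b)) * (u * b))"
    by (simp add: n_def)
  also have "\<dots> = root n (1 + C * (\<rho>\<^sup>2 / b)) * root n (u * b)"
    by (rule real_root_mult)
  also have "\<dots> \<le> (1 + C * (\<rho>\<^sup>2 / b)) * root n (u * b)"
    using x u b by (intro mult_right_mono root_one_plus_le) (auto simp: n_def)
  finally have "root n (enn2real (Vol A)) \<le> (1 + C * (\<rho>\<^sup>2 / b)) * root n (u * b)" .
  moreover have "Vol A < \<infinity>" using VA by (simp add: order_le_less_trans)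
  \<comment> \<open>The existential witness is still schematic and is fixed here; written out, it
    mentions only \<open>CARD('m)\<close>.\<close>
  ultimately show "let n = 2 * CARD('m) + 1;
             A0 = B \<times> {0..b};
             A1 = B \<times> {t..t + b};
             A = magnetic_average (1/2) A0 A1
         in Vol A < \<infinity> \<and>
            root n (enn2real (Vol A))
              \<le> (1 + (24 + 34 * 4 ^ (2 * CARD('m))) * (\<rho>\<^sup>2 / b)) *
                 ((root n (enn2real (Vol A0)) + root n (enn2real (Vol A1))) / 2)"
    using u b unfolding Let_def A_def[symmetric] V0 V1 C_def k_def n_def by simp
qed

end
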